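(* Let $\mathfrak{F}$ be a fractal curve with rise function $J$ as described in the context, let $\beta>0$, and let $f$ be a function on $\mathfrak{F}$ with fractal Mellin transform $M$ whose left-sided Riemann-Liouville integral ${}_{0}\mathcal{I}_{\theta}^{\beta}f$ is defined. Then the fractal Mellin transform of the fractal Riemann-Liouville integral of $f$ is $$\mathcal{M}\big[{}_{0}\mathcal{I}_{\theta}^{\beta}f(\theta)\big]=\frac{\Gamma(1-J(s)-\beta)}{\Gamma(1-J(s))}\,M(J(s)+\beta),$$ for every value $J(s)\in\mathbb{C}$ of the transform variable such that the Mellin transform of ${}_{0}\mathcal{I}_{\theta}^{\beta}f$ exists at $J(s)$, the Mellin transform of $f$ exists at $J(s)+\beta$, and the right-hand side is defined.
   Context: Fractal curve. $\mathfrak{F}\subset\mathbb{R}^{d}$ is a curve with a continuous bijective parametrization $\mathbf{v}:[0,\infty)\to\mathfrak{F}$, and $1\le\alpha\le d$. For $c_1<c_2$ the mass function is $$\zeta^{\alpha}(\mathfrak{F},c_1,c_2)=\lim_{\delta\to0}\ \inf_{|P|\le\delta}\ \sum_{i=0}^{N-1}\frac{|\mathbf{v}(z_{i+1})-\mathbf{v}(z_i)|^{\alpha}}{\Gamma(\alpha+1)},$$ the infimum being over subdivisions $P=\{c_1=z_0<\dots<z_N=c_2\}$ with mesh $|P|=\max_i(z_{i+1}-z_i)\le\delta$, and $|\cdot|$ on vectors the Euclidean norm. The rise function is $S_{\mathfrak{F}}^{\alpha}(z)=\zeta^{\alpha}(\mathfrak{F},0,z)$, and for $\theta=\mathbf{v}(z)$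 one writes $J(\theta)=S_{\mathfrak{F}}^{\alpha}(z)$. It is assumed that $S_{\mathfrak{F}}^{\alpha}$ is finite, continuous, strictly increasing and maps $[0,\infty)$ onto $[0,\infty)$. The point of $\mathfrak{F}$ with $J=0$ is written $0$. $\mathfrak{F}^{\alpha}$-integral. $D(c_1,c_2)$ denotes the section of $\mathfrak{F}$ between $\mathbf{v}(c_1)$ and $\mathbf{v}(c_2)$; $C(z_i,z_{i+1})$ denotes the part of $\mathfrak{F}$ between $\mathbf{v}(z_i)$ and $\mathbf{v}(z_{i+1})$. For a bounded real function $f$, $$\int_{D(c_1,c_2)}f(\theta)\,d_{\mathfrak{F}}^{\alpha}\theta=\sup_{P}\sum_{i}\inf_{\theta\in C(z_i,z_{i+1})}f(\theta)\,(J(\theta_{i+1})-J(\theta_i))=\inf_{P}\sum_{i}\sup_{\theta\in C(z_i,z_{i+1})}f(\theta)\,(J(\theta_{i+1})-J(\theta_i)),$$ where $\theta_i=\mathbf{v}(z_i)$, $P$ ranges over all subdivisions of $[c_1,c_2]$, and the two expressions are required to agree. Complex functions are integrated through real and imaginary parts, and integrals over $D(0,\infty)$ or of functions unbounded at an endpoint are (absolutely convergent) improper integrals. $D(0,\theta)$ is the section from the point $0$ to $\theta$; $D(0,1)$ and $D(1,\infty)$ in the Mellin conditions denote the parts of $\mathfrak{F}$ where $0\le J\le1$ and $J\ge1$. Left-sided Riemann-Liouville $F^{\alpha}$-integral of order $\beta$ (based at $0$): $${}_{0}\mathcal{I}_{\theta}^{\beta}f(\theta)=\frac{1}{\Gamma(\beta)}\int_{D(0,\theta)}\frac{f(\tau)}{(J(\theta)-J(\tau))^{1-\beta}}\,d_{\mathfrak{F}}^{\alpha}\tau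 .$$ Fractal Mellin transform. $$M(J(s))=\mathcal{M}[f(\theta)]=\int_{D(0,\infty)}f(\theta)\,J(\theta)^{J(s)-1}\,d_{\mathfrak{F}}^{\alpha}\theta,$$ where $J(s)$ denotes the complex transform variable. The transform of $f$ is said to exist at $J(s)$ if $f$ is piecewise continuous on every closed section $D(a,b)\subset D(0,\infty)$ and there are reals $\lambda_1<\mathrm{Re}\,J(s)<\lambda_2$ with $\int_{D(0,1)}|f(\theta)|J(\theta)^{\lambda_1-1}d_{\mathfrak{F}}^{\alpha}\theta<\infty$ and $\int_{D(1,\infty)}|f(\theta)|J(\theta)^{\lambda_2-1}d_{\mathfrak{F}}^{\alpha}\theta<\infty$. *)

theory Defs
  imports "HOL-Analysis.Analysis"
begin

text \<open>
  Throughout, \<open>v\<close> is the parametrization of the curve, used on \<open>[0,\<infinity>)\<close> only, and \<open>\<alpha>\<close> is the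
  dimension exponent. Sections of the curve are described by their end parameters.
\<close>

definition subdivision :: "real \<Rightarrow> real \<Rightarrow> real list \<Rightarrow> bool" where
  "subdivision c1 c2 z \<longleftrightarrow> z \<noteq> [] \<and> hd z = c1 \<and> last z = c2 \<and> sorted_wrt (<) z"

definition mesh_le :: "real list \<Rightarrow> real \<Rightarrow> bool" where
  "mesh_le z \<delta> \<longleftrightarrow> (\<forall>i<length z - 1. z ! Suc i - z ! i \<le> \<delta>)"

text \<open>
  The infimum increases as \<open>\<delta>\<close> decreases, so the limit exists in \<open>[0,\<infinity>]\<close>. For \<open>c1 = c2\<close> the only
  subdivision is \<open>[c1]\<close>, and the mass is \<open>0\<close>.
\<close>

definition mass :: "(real \<Rightarrow> real ^ 'd) \<Rightarrow> real \<Rightarrow> real \<Rightarrow> real \<Rightarrow> ennreal" where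
  "mass v \<alpha> c1 c2 =
     Lim (at_right 0) (\<lambda>\<delta>. INF z\<in>{z. subdivision c1 c2 z \<and> mesh_le z \<delta>}.
       ennreal (\<Sum>i<length z - 1. norm (v (z ! Suc i) - v (z ! i)) powr \<alpha> / Gamma (\<alpha> + 1)))"

definition rise :: "(real \<Rightarrow> real ^ 'd) \<Rightarrow> real \<Rightarrow> real \<Rightarrow> real" where
  "rise v \<alpha> z = enn2real (mass v \<alpha> 0 z)"

definition curve_param :: "(real \<Rightarrow> real ^ 'd) \<Rightarrow> real ^ 'd \<Rightarrow> real" where
  "curve_param v \<theta> = inv_into {0..} v \<theta>"

definition curve_J :: "(real \<Rightarrow> real ^ 'd) \<Rightarrow> real \<Rightarrow> real ^ 'd \<Rightarrow> real" where
  "curve_J v \<alpha> \<theta> = rise v \<alpha> (curve_param v \<theta>)"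

definition fractal_curve :: "(real ^ 'd) set \<Rightarrow> (real \<Rightarrow> real ^ 'd) \<Rightarrow> real \<Rightarrow> bool" where
  "fractal_curve F v \<alpha> \<longleftrightarrow>
     1 \<le> \<alpha> \<and> \<alpha> \<le> real CARD('d) \<and>
     continuous_on {0..} v \<and> bij_betw v {0..} F \<and>
     (\<forall>z\<ge>0. mass v \<alpha> 0 z < \<infinity>) \<and>
     continuous_on {0..} (rise v \<alpha>) \<and> strict_mono_on {0..} (rise v \<alpha>) \<and>
     rise v \<alpha> ` {0..} = {0..}"

definition curve_section :: "(real \<Rightarrow> real ^ 'd) \<Rightarrow> real \<Rightarrow> real \<Rightarrow> (real ^ 'd) set" where
  "curve_section v a b = v ` {a..b}"

definition lower_F_integral ::
  "(real \<Rightarrow> real ^ 'd) \<Rightarrow> real \<Rightarrow> (real ^ 'd \<Rightarrow> real) \<Rightarrow> real \<Rightarrow> real \<Rightarrow> real" where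
  "lower_F_integral v \<alpha> f c1 c2 =
     (SUP z\<in>{z. subdivision c1 c2 z}. \<Sum>i<length z - 1.
        (INF \<theta>\<in>curve_section v (z ! i) (z ! Suc i). f \<theta>) *
        (curve_J v \<alpha> (v (z ! Suc i)) - curve_J v \<alpha> (v (z ! i))))"

definition upper_F_integral ::
  "(real \<Rightarrow> real ^ 'd) \<Rightarrow> real \<Rightarrow> (real ^ 'd \<Rightarrow> real) \<Rightarrow> real \<Rightarrow> real \<Rightarrow> real" where
  "upper_F_integral v \<alpha> f c1 c2 =
     (INF z\<in>{z. subdivision c1 c2 z}. \<Sum>i<length z - 1.
        (SUP \<theta>\<in>curve_section v (z ! i) (z ! Suc i). f \<theta>) *
        (curve_J v \<alpha> (v (z ! Suc i)) - curve_J v \<alpha> (v (z ! i))))"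

definition has_proper_F_integral ::
  "(real \<Rightarrow> real ^ 'd) \<Rightarrow> real \<Rightarrow> (real ^ 'd \<Rightarrow> real) \<Rightarrow> real \<Rightarrow> real \<Rightarrow> real \<Rightarrow> bool" where
  "has_proper_F_integral v \<alpha> f c1 c2 I \<longleftrightarrow>
     c1 \<le> c2 \<and> bounded (f ` curve_section v c1 c2) \<and>
     lower_F_integral v \<alpha> f c1 c2 = I \<and> upper_F_integral v \<alpha> f c1 c2 = I"

text \<open>
  The improper integral over the parameter range \<open>(a,b)\<close>, where \<open>b\<close> may be \<open>\<infinity>\<close>: both end parameters
  of the inner section tend independently to \<open>a\<close> and \<open>b\<close>.
\<close>

definition inner_ends :: "real \<Rightarrow> ereal \<Rightarrow> (real \<times> real) filter" where
  "inner_ends a b = at_right a \<times>\<^sub>F (if b = \<infinity> then at_top else at_left (real_of_ereal b))"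

definition has_improper_F_integral ::
  "(real \<Rightarrow> real ^ 'd) \<Rightarrow> real \<Rightarrow> (real ^ 'd \<Rightarrow> real) \<Rightarrow> real \<Rightarrow> ereal \<Rightarrow> real \<Rightarrow> bool" where
  "has_improper_F_integral v \<alpha> f a b I \<longleftrightarrow>
     ereal a < b \<and>
     (\<forall>c d. a < c \<and> c \<le> d \<and> ereal d < b \<longrightarrow> (\<exists>K. has_proper_F_integral v \<alpha> f c d K)) \<and>
     (\<exists>K. ((\<lambda>(c, d). lower_F_integral v \<alpha> (\<lambda>\<theta>. \<bar>f \<theta>\<bar>) c d) \<longlongrightarrow> K) (inner_ends a b)) \<and>
     ((\<lambda>(c, d). lower_F_integral v \<alpha> f c d) \<longlongrightarrow> I) (inner_ends a b)"

text \<open>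
  If a proper integral over \<open>[a,b]\<close> with \<open>a < b\<close> exists, then so does the improper one, with the same
  value, because the rise function is continuous; hence the value is unique.
\<close>

definition has_F_integral ::
  "(real \<Rightarrow> real ^ 'd) \<Rightarrow> real \<Rightarrow> (real ^ 'd \<Rightarrow> real) \<Rightarrow> real \<Rightarrow> ereal \<Rightarrow> real \<Rightarrow> bool" where
  "has_F_integral v \<alpha> f a b I \<longleftrightarrow>
     (\<exists>c. b = ereal c \<and> has_proper_F_integral v \<alpha> f a c I) \<or> has_improper_F_integral v \<alpha> f a b I"

definition F_integrable ::
  "(real \<Rightarrow> real ^ 'd) \<Rightarrow> real \<Rightarrow> (real ^ 'd \<Rightarrow> real) \<Rightarrow> real \<Rightarrow> ereal \<Rightarrow> bool" where
  "F_integrable v \<alpha> f a b \<longleftrightarrow> (\<exists>I. has_F_integral v \<alpha> f a b I)"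

definition F_integral ::
  "(real \<Rightarrow> real ^ 'd) \<Rightarrow> real \<Rightarrow> (real ^ 'd \<Rightarrow> real) \<Rightarrow> real \<Rightarrow> ereal \<Rightarrow> real" where
  "F_integral v \<alpha> f a b = (THE I. has_F_integral v \<alpha> f a b I)"

definition complex_F_integrable ::
  "(real \<Rightarrow> real ^ 'd) \<Rightarrow> real \<Rightarrow> (real ^ 'd \<Rightarrow> complex) \<Rightarrow> real \<Rightarrow> ereal \<Rightarrow> bool" where
  "complex_F_integrable v \<alpha> f a b \<longleftrightarrow>
     F_integrable v \<alpha> (\<lambda>\<theta>. Re (f \<theta>)) a b \<and> F_integrable v \<alpha> (\<lambda>\<theta>. Im (f \<theta>)) a b"

definition complex_F_integral ::
  "(real \<Rightarrow> real ^ 'd) \<Rightarrow> real \<Rightarrow> (real ^ 'd \<Rightarrow> complex) \<Rightarrow> real \<Rightarrow> ereal \<Rightarrow> complex" where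
  "complex_F_integral v \<alpha> f a b =
     Complex (F_integral v \<alpha> (\<lambda>\<theta>. Re (f \<theta>)) a b) (F_integral v \<alpha> (\<lambda>\<theta>. Im (f \<theta>)) a b)"

definition RL_integrand ::
  "(real \<Rightarrow> real ^ 'd) \<Rightarrow> real \<Rightarrow> real \<Rightarrow> (real ^ 'd \<Rightarrow> complex) \<Rightarrow> real ^ 'd \<Rightarrow> real ^ 'd \<Rightarrow> complex" where
  "RL_integrand v \<alpha> \<beta> f \<theta> \<tau> =
     f \<tau> / complex_of_real ((curve_J v \<alpha> \<theta> - curve_J v \<alpha> \<tau>) powr (1 - \<beta>))"

definition RL_defined ::
  "(real \<Rightarrow> real ^ 'd) \<Rightarrow> real \<Rightarrow> real \<Rightarrow> (real ^ 'd \<Rightarrow> complex) \<Rightarrow> real ^ 'd \<Rightarrow> bool" where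
  "RL_defined v \<alpha> \<beta> f \<theta> \<longleftrightarrow>
     complex_F_integrable v \<alpha> (RL_integrand v \<alpha> \<beta> f \<theta>) 0 (ereal (curve_param v \<theta>))"

definition RL_integral ::
  "(real \<Rightarrow> real ^ 'd) \<Rightarrow> real \<Rightarrow> real \<Rightarrow> (real ^ 'd \<Rightarrow> complex) \<Rightarrow> real ^ 'd \<Rightarrow> complex" where
  "RL_integral v \<alpha> \<beta> f \<theta> =
     1 / complex_of_real (Gamma \<beta>) *
     complex_F_integral v \<alpha> (RL_integrand v \<alpha> \<beta> f \<theta>) 0 (ereal (curve_param v \<theta>))"

definition piecewise_continuous_section ::
  "(real \<Rightarrow> real ^ 'd) \<Rightarrow> (real ^ 'd \<Rightarrow> complex) \<Rightarrow> real \<Rightarrow> real \<Rightarrow> bool" where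
  "piecewise_continuous_section v f a b \<longleftrightarrow>
     (\<exists>z. subdivision a b z \<and> (\<forall>i<length z - 1.
        (let C = v ` {z ! i<..<z ! Suc i} in
           continuous_on C f \<and>
           (\<exists>l. (f \<longlongrightarrow> l) (at (v (z ! i)) within C)) \<and>
           (\<exists>r. (f \<longlongrightarrow> r) (at (v (z ! Suc i)) within C)))))"

text \<open>The parameter of the point of the curve where \<open>J = x\<close>.\<close>

definition level_param :: "(real \<Rightarrow> real ^ 'd) \<Rightarrow> real \<Rightarrow> real \<Rightarrow> real" where
  "level_param v \<alpha> x = inv_into {0..} (rise v \<alpha>) x"

text \<open>
  Piecewise continuity is asked only of closed sections away from the point \<open>J = 0\<close>, so \<open>f\<close> may be
  unbounded there.
\<close>

definition mellin_exists ::
  "(real \<Rightarrow> real ^ 'd) \<Rightarrow> real \<Rightarrow> (real ^ 'd \<Rightarrow> complex) \<Rightarrow> complex \<Rightarrow> bool" where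
  "mellin_exists v \<alpha> f s \<longleftrightarrow>
     (\<forall>a b. 0 < a \<and> a < b \<longrightarrow> piecewise_continuous_section v f a b) \<and>
     (\<exists>l1 l2. l1 < Re s \<and> Re s < l2 \<and>
        F_integrable v \<alpha> (\<lambda>\<theta>. norm (f \<theta>) * curve_J v \<alpha> \<theta> powr (l1 - 1))
          0 (ereal (level_param v \<alpha> 1)) \<and>
        F_integrable v \<alpha> (\<lambda>\<theta>. norm (f \<theta>) * curve_J v \<alpha> \<theta> powr (l2 - 1))
          (level_param v \<alpha> 1) \<infinity>)"

definition mellin ::
  "(real \<Rightarrow> real ^ 'd) \<Rightarrow> real \<Rightarrow> (real ^ 'd \<Rightarrow> complex) \<Rightarrow> complex \<Rightarrow> complex" where
  "mellin v \<alpha> f s =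
     complex_F_integral v \<alpha> (\<lambda>\<theta>. f \<theta> * complex_of_real (curve_J v \<alpha> \<theta>) powr (s - 1)) 0 \<infinity>"

end

theory Submission
  imports Defs
begin

text \<open>
  Measured by its level \<open>x = J(\<theta>)\<close>, the curve becomes the half-line \<open>[0,\<infinity>)\<close>, and the integral along
  the curve becomes the Lebesgue integral over levels: every Darboux sum brackets the Lebesgue
  integral, and for functions with one-sided limits the brackets close, because the rise function is
  continuous (\<open>has_F_integral_iff\<close>, \<open>complex_F_integral_eq_integral\<close>). Piecewise continuous functions
  have one-sided limits and are Borel functions of the level (\<open>piecewise_continuous_levels\<close>). It remains
  to prove, for \<open>f\<close> on the half-line and \<open>g(x) = 1/\<Gamma>(\<beta>) \<integral>\<^sub>0\<^sup>x f(t) (x - t)\<^bsup>\<beta>-1\<^esup> dt\<close>, that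
  \<open>M[g](s) = \<Gamma>(1-s-\<beta>)/\<Gamma>(1-s) M[f](s+\<beta>)\<close> as soon as both transforms converge absolutely
  (\<open>mellin_riemann_liouville\<close>).

  For \<open>Re (s+\<beta>) < 1\<close> one may exchange the integrals and use the Beta integral of
  \<open>x\<^bsup>s-1\<^esup> (x - t)\<^bsup>\<beta>-1\<^esup>\<close> over \<open>x > t\<close>. Outside this half-plane the Beta integral diverges, although both
  transforms may converge. Therefore a kernel is inserted. Let \<open>\<phi>\<close> be an exponential times a
  polynomial. Its Weyl fractional integral is a function \<open>\<psi>\<close> of the same kind, and by scaling that of
  \<open>\<phi>(p x)\<close> is \<open>p\<^bsup>-\<beta>\<^esup> \<psi>(p t)\<close>, so Fubini's theorem gives
  \<open>\<integral> g(x) \<phi>(p x) dx = p\<^bsup>-\<beta>\<^esup> \<integral> f(t) \<psi>(p t) dt\<close> for all \<open>p > 0\<close>. Multiplying by \<open>p\<^bsup>-s\<^esup>\<close> and integrating over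
  \<open>p\<close>, a second use of Fubini's theorem turns this into
  \<open>M[g](s) \<integral> q\<^bsup>-s\<^esup> \<phi>(q) dq = M[f](s+\<beta>) \<integral> q\<^bsup>-s-\<beta>\<^esup> \<psi>(q) dq\<close>. The two new integrals have to converge
  absolutely at \<open>0\<close>, which they do if both \<open>\<phi>\<close> and \<open>\<psi>\<close> vanish there to a high order \<open>N\<close>.

  Such a \<open>\<phi>\<close> exists: if the coefficients \<open>c\<^sub>k\<close> of its polynomial satisfy
  \<open>\<Sum> c\<^sub>k (w)\<^sub>k = (w)\<^sub>N (w-\<beta>)\<^sub>N\<close>, where \<open>(w)\<^sub>k\<close> is the rising factorial, then \<open>\<psi>\<close> has the coefficients with
  \<open>\<Sum> r\<^sub>m (u)\<^sub>m = (u+\<beta>)\<^sub>N (u)\<^sub>N\<close>, and both families vanish below \<open>N\<close> (\<open>sum_kernel_coeff\<close>, \<open>sum_dual_coeff\<close>,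
  \<open>dual_coeff_eq_0\<close>). The two integrals are then \<open>\<Gamma>(1-s)\<close> and \<open>\<Gamma>(1-s-\<beta>)\<close> times the same number
  \<open>(1-s)\<^sub>N (1-s-\<beta>)\<^sub>N\<close>, which the excluded poles keep away from \<open>0\<close>.
\<close>

section \<open>Sums over subdivisions\<close>

text \<open>
  Darboux sums are rewritten in this recursive form, in which concatenation and telescoping are
  inductions on the list.
\<close>

fun path_sum :: "(real \<Rightarrow> real \<Rightarrow> real) \<Rightarrow> real list \<Rightarrow> real" where
  "path_sum \<phi> (x # y # r) = \<phi> x y + path_sum \<phi> (y # r)"
| "path_sum \<phi> _ = 0"

lemma sum_nth_eq_path_sum: "(\<Sum>i<length z - 1. \<phi> (z ! i) (z ! Suc i)) = path_sum \<phi> z"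
  by (induction \<phi> z rule: path_sum.induct) (auto simp: sum.lessThan_Suc_shift simp del: sum.lessThan_Suc)

lemma path_sum_append:
  "z \<noteq> [] \<Longrightarrow> w \<noteq> [] \<Longrightarrow> last z = hd w \<Longrightarrow> path_sum \<phi> (z @ tl w) = path_sum \<phi> z + path_sum \<phi> w"
proof (induction \<phi> z rule: path_sum.induct)
  case ("2_2" \<phi> x)
  then show ?case by (cases w) auto
qed auto

lemma path_sum_diff: "path_sum (\<lambda>x y. \<phi> x y - \<psi> x y) z = path_sum \<phi> z - path_sum \<psi> z"
  by (induction z rule: induct_list012) auto

lemma subdivision_Cons_Cons:
  "subdivision c d (x # y # r) \<longleftrightarrow> x = c \<and> c < y \<and> subdivision y d (y # r)"
  by (auto simp: subdivision_def)

lemma subdivision_singleton: "subdivision c d [x] \<longleftrightarrow> x = c \<and> x = d"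
  by (auto simp: subdivision_def)

lemma subdivision_le: "subdivision c d z \<Longrightarrow> c \<le> d"
proof (induction z arbitrary: c rule: induct_list012)
  case (3 x y zs)
  then show ?case by (force simp: subdivision_Cons_Cons)
qed (auto simp: subdivision_def)

lemma subdivision_mem: "subdivision c d z \<Longrightarrow> t \<in> set z \<Longrightarrow> c \<le> t \<and> t \<le> d"
proof (induction z arbitrary: c rule: induct_list012)
  case (3 x y zs)
  then show ?case
    using subdivision_le[of c d "x # y # zs"] by (force simp: subdivision_Cons_Cons)
qed (auto simp: subdivision_def)

lemma subdivision_append:
  assumes "subdivision a b z" "subdivision b c w"
  shows "subdivision a c (z @ tl w)"
  using assms
proof (induction z arbitrary: a rule: induct_list012)
  case (2 x)
  then show ?case by (cases w) (auto simp: subdivision_def)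
next
  case (3 x y zs)
  then show ?case by (auto simp: subdivision_Cons_Cons)
qed (auto simp: subdivision_def)

text \<open>
  The comparison of Darboux sums with an integral: \<open>G\<close> will be the integral up to a given level,
  whose increments bound the terms of the sum.
\<close>

lemma path_sum_le_telescope:
  assumes "subdivision c d z" "\<And>x y. c \<le> x \<Longrightarrow> x < y \<Longrightarrow> y \<le> d \<Longrightarrow> \<phi> x y \<le> G y - G x"
  shows "path_sum \<phi> z \<le> G d - (G c :: real)"
  using assms
proof (induction z arbitrary: c rule: induct_list012)
  case (3 x y zs)
  have "path_sum \<phi> (y # zs) \<le> G d - G y"
    using "3.prems" by (intro "3.IH") (auto simp: subdivision_Cons_Cons)
  moreover have "\<phi> x y \<le> G y - G x"
    using "3.prems" subdivision_le[of y d "y # zs"] by (auto simp: subdivision_Cons_Cons)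
  ultimately show ?case
    using "3.prems" by (simp add: subdivision_Cons_Cons)
qed (auto simp: subdivision_def)

lemma path_sum_ge_telescope:
  assumes "subdivision c d z" "\<And>x y. c \<le> x \<Longrightarrow> x < y \<Longrightarrow> y \<le> d \<Longrightarrow> G y - G x \<le> \<phi> x y"
  shows "G d - (G c :: real) \<le> path_sum \<phi> z"
proof -
  have "path_sum (\<lambda>x y. 0 - \<phi> x y) z \<le> - G d - - G c"
    by (rule path_sum_le_telescope[OF assms(1)]) (use assms(2) in fastforce)
  moreover have "path_sum (\<lambda>_ _. 0) z = 0"
    by (induction z rule: induct_list012) auto
  ultimately show ?thesis
    using path_sum_diff[of "\<lambda>_ _. 0" \<phi> z] by simp
qed

text \<open>
  The two versions serve limits from the right and from the left: the point may be the left end,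
  respectively the right end, of the interval that is found.
\<close>

lemma subdivision_locate:
  assumes "subdivision c d z" "c \<le> t" "t < d"
  shows "\<exists>i<length z - 1. z ! i \<le> t \<and> t < z ! Suc i"
  using assms
proof (induction z arbitrary: c rule: induct_list012)
  case (3 x y zs)
  show ?case
  proof (cases "t < y")
    case True
    then show ?thesis
      using 3 by (intro exI[of _ 0]) (auto simp: subdivision_Cons_Cons)
  next
    case False
    have "\<exists>i<length (y # zs) - 1. (y # zs) ! i \<le> t \<and> t < (y # zs) ! Suc i"
      by (rule "3.IH"(2)) (use "3.prems" False in \<open>auto simp: subdivision_Cons_Cons\<close>)
    then obtain i where "i < length (y # zs) - 1" "(y # zs) ! i \<le> t" "t < (y # zs) ! Suc i"
      by blast
    then show ?thesis
      by (intro exI[of _ "Suc i"]) auto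
  qed
qed (auto simp: subdivision_def)

lemma subdivision_locate':
  assumes "subdivision c d z" "c < t" "t \<le> d"
  shows "\<exists>i<length z - 1. z ! i < t \<and> t \<le> z ! Suc i"
  using assms
proof (induction z arbitrary: c rule: induct_list012)
  case (3 x y zs)
  show ?case
  proof (cases "t \<le> y")
    case True
    then show ?thesis
      using 3 by (intro exI[of _ 0]) (auto simp: subdivision_Cons_Cons)
  next
    case False
    have "\<exists>i<length (y # zs) - 1. (y # zs) ! i < t \<and> t \<le> (y # zs) ! Suc i"
      by (rule "3.IH"(2)) (use "3.prems" False in \<open>auto simp: subdivision_Cons_Cons\<close>)
    then obtain i where "i < length (y # zs) - 1" "(y # zs) ! i < t" "t \<le> (y # zs) ! Suc i"
      by blast
    then show ?thesis
      by (intro exI[of _ "Suc i"]) auto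
  qed
qed (auto simp: subdivision_def)

section \<open>Functions with one-sided limits\<close>

text \<open>
  No value of \<open>u\<close> is constrained at a point of discontinuity, so this covers piecewise continuous
  functions with arbitrary values at the break points, and it is closed under algebraic operations.
\<close>

definition one_sided_limits :: "(real \<Rightarrow> 'a::topological_space) \<Rightarrow> real \<Rightarrow> ereal \<Rightarrow> bool" where
  "one_sided_limits u a b \<longleftrightarrow>
     (\<forall>z. a < z \<longrightarrow> ereal z < b \<longrightarrow> (\<exists>l. (u \<longlongrightarrow> l) (at_left z)) \<and> (\<exists>r. (u \<longlongrightarrow> r) (at_right z)))"

lemma one_sided_limits_compose:
  assumes "one_sided_limits u a b" "continuous_on UNIV g"
  shows "one_sided_limits (\<lambda>z. g (u z)) a b"
proof -
  have "((\<lambda>z. g (u z)) \<longlongrightarrow> g l) Q" if "(u \<longlongrightarrow> l) Q" for l Q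
    using that assms(2) continuous_on_tendsto_compose[of UNIV g u l Q] by simp
  then show ?thesis
    using assms(1) unfolding one_sided_limits_def by blast
qed

lemma one_sided_limits_mult:
  fixes u w :: "real \<Rightarrow> 'a::real_normed_algebra"
  shows "one_sided_limits u a b \<Longrightarrow> one_sided_limits w a b \<Longrightarrow> one_sided_limits (\<lambda>z. u z * w z) a b"
  unfolding one_sided_limits_def by (blast intro: tendsto_mult)

lemma one_sided_limits_isCont:
  "(\<And>z. a < z \<Longrightarrow> ereal z < b \<Longrightarrow> isCont w z) \<Longrightarrow> one_sided_limits w a b"
  unfolding one_sided_limits_def isCont_def by (meson filterlim_at_split)

lemma one_sided_limits_subset:
  "one_sided_limits u a b \<Longrightarrow> a \<le> a' \<Longrightarrow> b' \<le> b \<Longrightarrow> one_sided_limits u a' b'"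
  unfolding one_sided_limits_def by (meson order_le_less_trans order_less_le_trans)

lemma eventually_at_between:
  assumes "a < z" "ereal z < b"
  shows "eventually (\<lambda>t. a < t \<and> ereal t < b) (at z within A)"
proof -
  have "open ({a<..} \<inter> ereal -` {..<b})"
    by (intro open_Int open_vimage continuous_on_ereal continuous_on_id open_greaterThan open_lessThan)
  then have "eventually (\<lambda>t. t \<in> {a<..} \<inter> ereal -` {..<b}) (nhds z)"
    by (rule eventually_nhds_in_open) (use assms in auto)
  then show ?thesis
    unfolding eventually_at_filter by (rule eventually_mono) auto
qed

lemma one_sided_limits_cong:
  assumes "\<And>z. a < z \<Longrightarrow> ereal z < b \<Longrightarrow> u z = w z"
  shows "one_sided_limits u a b \<longleftrightarrow> one_sided_limits w a b"
proof -
  have "(u \<longlongrightarrow> l) (at z within A) \<longleftrightarrow> (w \<longlongrightarrow> l) (at z within A)" if "a < z" "ereal z < b" for z l A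
    using eventually_mono[OF eventually_at_between[OF that]] assms by (intro tendsto_cong) auto
  then show ?thesis
    unfolding one_sided_limits_def by blast
qed

text \<open>
  The form used in the bisection arguments: near any point the function is almost constant on each
  side, the point itself excepted.
\<close>

lemma one_sided_limits_locally_close:
  fixes u :: "real \<Rightarrow> 'a::metric_space"
  assumes "one_sided_limits u a b" "a < z" "ereal z < b" "e > 0"
  obtains l r \<delta> where "\<delta> > 0" "\<And>t. z - \<delta> < t \<Longrightarrow> t < z \<Longrightarrow> dist (u t) l < e"
    "\<And>t. z < t \<Longrightarrow> t < z + \<delta> \<Longrightarrow> dist (u t) r < e"
proof -
  obtain l r where l: "(u \<longlongrightarrow> l) (at_left z)" and r: "(u \<longlongrightarrow> r) (at_right z)"
    using assms unfolding one_sided_limits_def by blast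
  obtain p where p: "p < z" "\<And>t. p < t \<Longrightarrow> t < z \<Longrightarrow> dist (u t) l < e"
    using tendstoD[OF l \<open>e > 0\<close>] unfolding eventually_at_left_field by blast
  obtain q where q: "q > z" "\<And>t. z < t \<Longrightarrow> t < q \<Longrightarrow> dist (u t) r < e"
    using tendstoD[OF r \<open>e > 0\<close>] unfolding eventually_at_right_field by blast
  show thesis
    by (rule that[of "min (z - p) (q - z)" l r]) (use p q in auto)
qed

lemma one_sided_limits_bounded:
  fixes u :: "real \<Rightarrow> real"
  assumes u: "one_sided_limits u a b" and cd: "a < c" "c \<le> d" "ereal d < b"
  obtains B where "\<And>t. t \<in> {c..d} \<Longrightarrow> \<bar>u t\<bar> \<le> B"
proof -
  have "\<exists>B. \<forall>t\<in>{c..d}. \<bar>u t\<bar> \<le> B"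
    using cd(2)
  proof (induction rule: Bolzano)
    case (trans x y z)
    then obtain B B' where "\<forall>t\<in>{x..y}. \<bar>u t\<bar> \<le> B" "\<forall>t\<in>{y..z}. \<bar>u t\<bar> \<le> B'"
      by blast
    then have "\<forall>t\<in>{x..z}. \<bar>u t\<bar> \<le> max B B'"
      by (metis atLeastAtMost_iff le_max_iff_disj nle_le)
    then show ?case ..
  next
    case (local x)
    have "a < x" "ereal x < b"
      using local cd by (auto intro: le_less_trans[of "ereal x" "ereal d"])
    then obtain l r \<delta> where \<delta>: "\<delta> > 0" and lr: "\<And>t. x - \<delta> < t \<Longrightarrow> t < x \<Longrightarrow> dist (u t) l < 1"
        "\<And>t. x < t \<Longrightarrow> t < x + \<delta> \<Longrightarrow> dist (u t) r < 1"
      using one_sided_limits_locally_close[OF u, of x 1] by (metis zero_less_one)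
    have "\<bar>u t\<bar> \<le> \<bar>l\<bar> + \<bar>r\<bar> + \<bar>u x\<bar> + 1" if "\<bar>t - x\<bar> < \<delta>" for t
      using that lr[of t] by (cases t x rule: linorder_cases) (auto simp: dist_real_def)
    then have "\<forall>p q. p \<le> x \<and> x \<le> q \<and> q - p < \<delta> \<longrightarrow> (\<exists>B. \<forall>t\<in>{p..q}. \<bar>u t\<bar> \<le> B)"
      by (intro allI impI exI[of _ "\<bar>l\<bar> + \<bar>r\<bar> + \<bar>u x\<bar> + 1"]) auto
    then show ?case
      using \<delta> by blast
  qed
  then show thesis
    using that by blast
qed

section \<open>Levels of the rise function\<close>

text \<open>
  The rise function \<open>S\<close> is an increasing homeomorphism of \<open>[0,\<infinity>)\<close>. Its inverse \<open>T\<close> sends a level \<open>x\<close>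
  to the parameter of the point where \<open>J = x\<close>.
\<close>

locale fractal_curve_param =
  fixes F :: "(real ^ 'd) set" and v :: "real \<Rightarrow> real ^ 'd" and \<alpha> :: real
  assumes curve: "fractal_curve F v \<alpha>"
begin

abbreviation S where "S \<equiv> rise v \<alpha>"
abbreviation T where "T \<equiv> level_param v \<alpha>"

lemma S_continuous: "continuous_on {0..} S" and S_strict_mono: "strict_mono_on {0..} S"
  and S_image: "S ` {0..} = {0..}" and v_continuous: "continuous_on {0..} v" and v_bij: "bij_betw v {0..} F"
  using curve by (auto simp: fractal_curve_def)

lemma S_less_iff: "a \<ge> 0 \<Longrightarrow> b \<ge> 0 \<Longrightarrow> S a < S b \<longleftrightarrow> a < b"
  using strict_mono_on_less[OF S_strict_mono] by simp

lemma S_le_iff: "a \<ge> 0 \<Longrightarrow> b \<ge> 0 \<Longrightarrow> S a \<le> S b \<longleftrightarrow> a \<le> b"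
  using S_less_iff[of b a] by (simp flip: not_less)

lemma S_nonneg: "z \<ge> 0 \<Longrightarrow> S z \<ge> 0"
  using S_image by auto

lemma S_T: "x \<ge> 0 \<Longrightarrow> S (T x) = x" and T_nonneg: "x \<ge> 0 \<Longrightarrow> T x \<ge> 0"
  using f_inv_into_f[of x S "{0..}"] inv_into_into[of x S "{0..}"] S_image
  unfolding level_param_def by auto

lemma T_S: "z \<ge> 0 \<Longrightarrow> T (S z) = z"
  unfolding level_param_def using strict_mono_on_imp_inj_on[OF S_strict_mono] by (simp add: inv_into_f_f)

lemma S_0: "S 0 = 0"
  using S_T[of 0] T_nonneg[of 0] S_le_iff[of 0 "T 0"] S_nonneg[of 0] by simp

lemma T_le_iff: "x \<ge> 0 \<Longrightarrow> c \<ge> 0 \<Longrightarrow> T x \<le> c \<longleftrightarrow> x \<le> S c"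
  and T_less_iff: "x \<ge> 0 \<Longrightarrow> c \<ge> 0 \<Longrightarrow> T x < c \<longleftrightarrow> x < S c"
  and less_T_iff: "x \<ge> 0 \<Longrightarrow> c \<ge> 0 \<Longrightarrow> c < T x \<longleftrightarrow> S c < x"
  using S_le_iff[of "T x" c] S_less_iff[of "T x" c] S_less_iff[of c "T x"] by (auto simp: S_T T_nonneg)

lemma isCont_S: "z > 0 \<Longrightarrow> isCont S z" and isCont_v: "z > 0 \<Longrightarrow> isCont v z"
  using S_continuous v_continuous by (auto intro: continuous_on_interior simp: interior_real_atLeast)

lemma isCont_T:
  assumes "x > 0"
  shows "isCont T x"
proof -
  have "T ` {0<..} = {0<..}"
  proof
    show "T ` {0<..} \<subseteq> {0<..}"
      using less_T_iff[of _ 0] S_0 by auto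
    show "{0<..} \<subseteq> T ` {0<..}"
    proof
      fix z :: real assume "z \<in> {0<..}"
      then have "z = T (S z)" "S z > 0"
        using T_S[of z] S_less_iff[of 0 z] S_0 by auto
      then show "z \<in> T ` {0<..}"
        by auto
    qed
  qed
  then have "continuous_on {0<..} T"
    using T_le_iff by (intro continuous_onI_mono) (auto simp: S_T T_nonneg)
  then show ?thesis
    using assms by (simp add: continuous_on_eq_continuous_at)
qed

lemma curve_param_v: "z \<ge> 0 \<Longrightarrow> curve_param v (v z) = z"
  using v_bij by (simp add: curve_param_def bij_betw_def inv_into_f_f)

lemma curve_J_v: "z \<ge> 0 \<Longrightarrow> curve_J v \<alpha> (v z) = S z"
  by (simp add: curve_J_def curve_param_v)

section \<open>The integral along the curve as a Lebesgue integral over levels\<close>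

definition lower_term :: "(real \<Rightarrow> real) \<Rightarrow> real \<Rightarrow> real \<Rightarrow> real" where
  "lower_term u x y = (INF t\<in>{x..y}. u t) * (S y - S x)"

definition upper_term :: "(real \<Rightarrow> real) \<Rightarrow> real \<Rightarrow> real \<Rightarrow> real" where
  "upper_term u x y = (SUP t\<in>{x..y}. u t) * (S y - S x)"

lemma lower_F_integral_eq:
  assumes "c \<ge> 0"
  shows "lower_F_integral v \<alpha> h c d = (SUP z\<in>{z. subdivision c d z}. path_sum (lower_term (\<lambda>t. h (v t))) z)"
  unfolding lower_F_integral_def
proof (rule SUP_cong)
  fix z assume "z \<in> {z. subdivision c d z}"
  then have "z ! i \<ge> 0" if "i < length z" for i
    using subdivision_mem[of c d z "z ! i"] assms that by force
  then have "(\<Sum>i<length z - 1. (INF \<theta>\<in>curve_section v (z ! i) (z ! Suc i). h \<theta>) *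
      (curve_J v \<alpha> (v (z ! Suc i)) - curve_J v \<alpha> (v (z ! i)))) =
      (\<Sum>i<length z - 1. lower_term (\<lambda>t. h (v t)) (z ! i) (z ! Suc i))"
    by (intro sum.cong) (auto simp: lower_term_def curve_section_def image_image curve_J_v)
  then show "(\<Sum>i<length z - 1. (INF \<theta>\<in>curve_section v (z ! i) (z ! Suc i). h \<theta>) *
      (curve_J v \<alpha> (v (z ! Suc i)) - curve_J v \<alpha> (v (z ! i)))) = path_sum (lower_term (\<lambda>t. h (v t))) z"
    by (simp only: sum_nth_eq_path_sum)
qed simp

lemma upper_F_integral_eq:
  assumes "c \<ge> 0"
  shows "upper_F_integral v \<alpha> h c d = (INF z\<in>{z. subdivision c d z}. path_sum (upper_term (\<lambda>t. h (v t))) z)"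
  unfolding upper_F_integral_def
proof (rule INF_cong)
  fix z assume "z \<in> {z. subdivision c d z}"
  then have "z ! i \<ge> 0" if "i < length z" for i
    using subdivision_mem[of c d z "z ! i"] assms that by force
  then have "(\<Sum>i<length z - 1. (SUP \<theta>\<in>curve_section v (z ! i) (z ! Suc i). h \<theta>) *
      (curve_J v \<alpha> (v (z ! Suc i)) - curve_J v \<alpha> (v (z ! i)))) =
      (\<Sum>i<length z - 1. upper_term (\<lambda>t. h (v t)) (z ! i) (z ! Suc i))"
    by (intro sum.cong) (auto simp: upper_term_def curve_section_def image_image curve_J_v)
  then show "(\<Sum>i<length z - 1. (SUP \<theta>\<in>curve_section v (z ! i) (z ! Suc i). h \<theta>) *
      (curve_J v \<alpha> (v (z ! Suc i)) - curve_J v \<alpha> (v (z ! i)))) = path_sum (upper_term (\<lambda>t. h (v t))) z"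
    by (simp only: sum_nth_eq_path_sum)
qed simp

text \<open>
  Bisection reduces the claim to short intervals with \<open>x\<close> as an end. On the open side of \<open>x\<close> the
  function is almost constant; the value at \<open>x\<close> itself may be off, so a piece next to \<open>x\<close> is split off
  whose mass is so small, by continuity of \<open>S\<close>, that a bound \<open>B\<close> on the function suffices there. Since
  the tolerance is proportional to the mass \<open>S d - S c\<close>, it adds up under concatenation.
\<close>

lemma ex_fine_subdivision:
  fixes u :: "real \<Rightarrow> real"
  assumes u: "one_sided_limits u a b" and cd: "0 \<le> a" "a < c" "c \<le> d" "ereal d < b" and "\<epsilon> > 0"
  shows "\<exists>z. subdivision c d z \<and> path_sum (\<lambda>x y. upper_term u x y - lower_term u x y) z \<le> \<epsilon> * (S d - S c)"
  using cd(3)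
proof (induction rule: Bolzano)
  case (trans x y z)
  then obtain p q where "subdivision x y p" "subdivision y z q"
    "path_sum (\<lambda>x y. upper_term u x y - lower_term u x y) p \<le> \<epsilon> * (S y - S x)"
    "path_sum (\<lambda>x y. upper_term u x y - lower_term u x y) q \<le> \<epsilon> * (S z - S y)"
    by blast
  then show ?case
    by (intro exI[of _ "p @ tl q"] conjI subdivision_append[of x y p z q])
      (auto simp: path_sum_append subdivision_def algebra_simps)
next
  case (local x)
  let ?gap = "\<lambda>x y. upper_term u x y - lower_term u x y"
  have gap: "?gap p q \<le> (A' - A) * (S q - S p)"
    if "0 \<le> p" "p \<le> q" "\<And>t. t \<in> {p..q} \<Longrightarrow> A \<le> u t \<and> u t \<le> A'" for p q A A'
  proof -
    have "(SUP t\<in>{p..q}. u t) \<le> A'" "A \<le> (INF t\<in>{p..q}. u t)"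
      using that by (auto intro!: cSUP_least cINF_greatest)
    then show ?thesis
      using that S_le_iff[of p q] unfolding upper_term_def lower_term_def left_diff_distrib[symmetric]
      by (intro mult_right_mono) auto
  qed
  have x: "a < x" "ereal x < b"
    using local cd by (auto intro: le_less_trans[of "ereal x" "ereal d"])
  then have "x > 0"
    using cd by simp
  obtain l r \<delta> where \<delta>: "\<delta> > 0" and lr: "\<And>t. x - \<delta> < t \<Longrightarrow> t < x \<Longrightarrow> dist (u t) l < \<epsilon> / 4"
      "\<And>t. x < t \<Longrightarrow> t < x + \<delta> \<Longrightarrow> dist (u t) r < \<epsilon> / 4"
    using one_sided_limits_locally_close[OF u x, of "\<epsilon> / 4"] \<open>\<epsilon> > 0\<close>
    by (metis zero_less_divide_iff zero_less_numeral)
  define B where "B = \<bar>l\<bar> + \<bar>r\<bar> + \<bar>u x\<bar> + \<epsilon>"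
  have near: "\<bar>y\<bar> \<le> \<bar>k\<bar> + \<epsilon>" if "dist y k < \<epsilon> / 4" for y k :: real
    using that \<open>\<epsilon> > 0\<close> unfolding dist_real_def by linarith
  have "\<bar>u t\<bar> \<le> B" if "\<bar>t - x\<bar> < \<delta>" for t
  proof (cases t x rule: linorder_cases)
    case less
    then show ?thesis
      using near[OF lr(1)[of t]] that unfolding B_def by linarith
  next
    case equal
    then show ?thesis
      using \<open>\<epsilon> > 0\<close> by (simp add: B_def)
  next
    case greater
    then show ?thesis
      using near[OF lr(2)[of t]] that unfolding B_def by linarith
  qed
  then have B: "- B \<le> u t \<and> u t \<le> B" if "\<bar>t - x\<bar> < \<delta>" for t
    using that by (meson abs_le_D1 abs_le_D2 minus_le_iff)
  have "B > 0"
    using \<open>\<epsilon> > 0\<close> by (auto simp: B_def)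
  \<comment> \<open>\<open>\<kappa>\<close> is the mass of the piece next to \<open>x\<close>, \<open>s\<close> that of the remaining piece, \<open>w\<close> that of the
    whole interval: each piece may contribute half of the tolerance.\<close>
  have combine: "2 * B * \<kappa> + \<epsilon> / 2 * s \<le> \<epsilon> * w" if "\<kappa> < \<epsilon> * w / (4 * B)" "s \<le> w" for \<kappa> s w
  proof -
    have "2 * B * \<kappa> \<le> \<epsilon> / 2 * w"
      using that(1) \<open>B > 0\<close> by (simp add: field_simps)
    moreover have "\<epsilon> / 2 * s \<le> \<epsilon> / 2 * w"
      using that(2) \<open>\<epsilon> > 0\<close> by (intro mult_left_mono) auto
    ultimately show ?thesis
      by linarith
  qed
  define P where "P p q \<longleftrightarrow> (\<exists>z. subdivision p q z \<and> path_sum ?gap z \<le> \<epsilon> * (S q - S p))" for p q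
  have right: "P x q" if q: "x < q" "q - x < \<delta>" for q
  proof -
    define \<kappa> where "\<kappa> = \<epsilon> * (S q - S x) / (4 * B)"
    have "\<kappa> > 0"
      using \<open>x > 0\<close> q S_less_iff[of x q] \<open>B > 0\<close> \<open>\<epsilon> > 0\<close> by (simp add: \<kappa>_def)
    have "(S \<longlongrightarrow> S x) (at_right x)"
      using isCont_S[OF \<open>x > 0\<close>] by (auto simp: isCont_def filterlim_at_split)
    then have "eventually (\<lambda>m. dist (S m) (S x) < \<kappa>) (at_right x)"
      using \<open>\<kappa> > 0\<close> by (rule tendstoD)
    moreover have "eventually (\<lambda>m. m \<in> {x<..<q}) (at_right x)"
      using q(1) by (rule eventually_at_right_real)
    ultimately have "eventually (\<lambda>m. dist (S m) (S x) < \<kappa> \<and> m \<in> {x<..<q}) (at_right x)"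
      by (rule eventually_conj)
    then obtain m where m: "dist (S m) (S x) < \<kappa>" "x < m" "m < q"
      using eventually_happens by fastforce
    have "?gap x m \<le> (B - - B) * (S m - S x)"
      using m q \<open>x > 0\<close> by (intro gap B) auto
    moreover have "?gap m q \<le> (r + \<epsilon> / 4 - (r - \<epsilon> / 4)) * (S q - S m)"
    proof (rule gap)
      fix t assume "t \<in> {m..q}"
      then have "dist (u t) r < \<epsilon> / 4"
        using m q by (intro lr(2)) auto
      then show "r - \<epsilon> / 4 \<le> u t \<and> u t \<le> r + \<epsilon> / 4"
        unfolding dist_real_def by linarith
    qed (use m \<open>x > 0\<close> in auto)
    moreover have "2 * B * (S m - S x) + \<epsilon> / 2 * (S q - S m) \<le> \<epsilon> * (S q - S x)"
      using m S_less_iff[of x m] \<open>x > 0\<close> by (intro combine) (simp_all add: \<kappa>_def dist_real_def)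
    ultimately have "path_sum ?gap [x, m, q] \<le> \<epsilon> * (S q - S x)"
      by simp
    then show ?thesis
      using m unfolding P_def
      by (intro exI[of _ "[x, m, q]"]) (auto simp: subdivision_Cons_Cons subdivision_singleton)
  qed
  have left: "P p x" if p: "0 \<le> p" "p < x" "x - p < \<delta>" for p
  proof -
    define \<kappa> where "\<kappa> = \<epsilon> * (S x - S p) / (4 * B)"
    have "\<kappa> > 0"
      using p S_less_iff[of p x] \<open>B > 0\<close> \<open>\<epsilon> > 0\<close> by (simp add: \<kappa>_def)
    have "(S \<longlongrightarrow> S x) (at_left x)"
      using isCont_S[OF \<open>x > 0\<close>] by (auto simp: isCont_def filterlim_at_split)
    then have "eventually (\<lambda>m. dist (S m) (S x) < \<kappa>) (at_left x)"
      using \<open>\<kappa> > 0\<close> by (rule tendstoD)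
    moreover have "eventually (\<lambda>m. m \<in> {p<..<x}) (at_left x)"
      using p by (intro eventually_at_left_real)
    ultimately have "eventually (\<lambda>m. dist (S m) (S x) < \<kappa> \<and> m \<in> {p<..<x}) (at_left x)"
      by (rule eventually_conj)
    then obtain m where m: "dist (S m) (S x) < \<kappa>" "p < m" "m < x"
      using eventually_happens by fastforce
    have "?gap m x \<le> (B - - B) * (S x - S m)"
      using m p by (intro gap B) auto
    moreover have "?gap p m \<le> (l + \<epsilon> / 4 - (l - \<epsilon> / 4)) * (S m - S p)"
    proof (rule gap)
      fix t assume "t \<in> {p..m}"
      then have "dist (u t) l < \<epsilon> / 4"
        using m p by (intro lr(1)) auto
      then show "l - \<epsilon> / 4 \<le> u t \<and> u t \<le> l + \<epsilon> / 4"
        unfolding dist_real_def by linarith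
    qed (use m p in auto)
    moreover have "2 * B * (S x - S m) + \<epsilon> / 2 * (S m - S p) \<le> \<epsilon> * (S x - S p)"
      using m p S_less_iff[of m x] by (intro combine) (simp_all add: \<kappa>_def dist_real_def)
    ultimately have "path_sum ?gap [p, m, x] \<le> \<epsilon> * (S x - S p)"
      by simp
    then show ?thesis
      using m unfolding P_def
      by (intro exI[of _ "[p, m, x]"]) (auto simp: subdivision_Cons_Cons subdivision_singleton)
  qed
  have refl: "P x x"
    unfolding P_def by (intro exI[of _ "[x]"]) (simp add: subdivision_singleton)
  have trans: "P p q" if pq: "P p x" "P x q" for p q
  proof -
    obtain z w where "subdivision p x z" "subdivision x q w"
      "path_sum ?gap z \<le> \<epsilon> * (S x - S p)" "path_sum ?gap w \<le> \<epsilon> * (S q - S x)"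
      using pq unfolding P_def by blast
    then show ?thesis
      unfolding P_def by (intro exI[of _ "z @ tl w"] conjI subdivision_append[of p x z q w])
        (auto simp: path_sum_append subdivision_def algebra_simps)
  qed
  have "\<forall>p q. p \<le> x \<and> x \<le> q \<and> q - p < min \<delta> x \<longrightarrow> P p q"
  proof (intro allI impI)
    fix p q assume pq: "p \<le> x \<and> x \<le> q \<and> q - p < min \<delta> x"
    have "P p x"
      using left[of p] refl pq by (cases "p = x") auto
    moreover have "P x q"
      using right[of q] refl pq by (cases "q = x") auto
    ultimately show "P p q"
      by (rule trans)
  qed
  moreover have "min \<delta> x > 0"
    using \<delta> \<open>x > 0\<close> by simp
  ultimately have "\<exists>d>0. \<forall>p q. p \<le> x \<and> x \<le> q \<and> q - p < d \<longrightarrow> P p q"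
    by blast
  then show ?case
    unfolding P_def .
qed

abbreviation level_measurable :: "(real \<Rightarrow> real) \<Rightarrow> bool" where
  "level_measurable u \<equiv> set_borel_measurable lborel {0<..} (\<lambda>x. u (T x))"

lemma T_mem: "0 \<le> c \<Longrightarrow> 0 \<le> d \<Longrightarrow> x \<in> {S c<..S d} \<Longrightarrow> c < T x \<and> T x \<le> d"
  using S_nonneg[of c] by (auto simp: T_le_iff less_T_iff)

lemma set_integrable_const_Ioc: "set_integrable lborel {a<..b} (\<lambda>_. K)" for a b K :: real
  by (rule set_integrable_subset[OF borel_integrable_atLeastAtMost'[of a b]]) auto

lemma set_integrable_levels:
  assumes u: "level_measurable u" and cd: "0 \<le> c" "c \<le> d" and B: "\<And>t. t \<in> {c..d} \<Longrightarrow> \<bar>u t\<bar> \<le> B"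
  shows "set_integrable lborel {S c<..S d} (\<lambda>x. u (T x))"
proof (rule set_integrable_bound)
  show "set_integrable lborel {S c<..S d} (\<lambda>_. B)"
    by (rule set_integrable_const_Ioc)
  show "set_borel_measurable lborel {S c<..S d} (\<lambda>x. u (T x))"
    by (rule set_borel_measurable_subset[OF u]) (use S_nonneg[OF cd(1)] in auto)
  have "\<bar>u (T x)\<bar> \<le> \<bar>B\<bar>" if "x \<in> {S c<..S d}" for x
    using B[of "T x"] T_mem[of c d x] that cd by force
  then show "AE x in lborel. x \<in> {S c<..S d} \<longrightarrow> norm (u (T x)) \<le> norm B"
    by simp
qed

lemma set_integral_const_levels: "a \<le> b \<Longrightarrow> (LINT x:{a<..b}|lborel. K) = K * (b - a)" for K :: real
  by (simp add: set_lebesgue_integral_def)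

lemma integral_levels_between:
  assumes u: "level_measurable u" and cd: "0 \<le> c" "c \<le> d" and B: "\<And>t. t \<in> {c..d} \<Longrightarrow> \<bar>u t\<bar> \<le> B"
  shows "lower_term u c d \<le> (LINT x:{S c<..S d}|lborel. u (T x))"
    and "(LINT x:{S c<..S d}|lborel. u (T x)) \<le> upper_term u c d"
proof -
  note int = set_integrable_levels[OF assms]
  have S: "S c \<le> S d"
    using cd S_le_iff by simp
  have bdd: "bdd_below (u ` {c..d})" "bdd_above (u ` {c..d})"
    using abs_le_D1[OF B] abs_le_D2[OF B]
    by (auto intro!: bdd_belowI2[of _ "- B"] bdd_aboveI2[of _ _ B] simp: minus_le_iff)
  have mem: "T x \<in> {c..d}" if "x \<in> {S c<..S d}" for x
    using T_mem[of c d x] that cd by auto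
  have "(LINT x:{S c<..S d}|lborel. INF t\<in>{c..d}. u t) \<le> (LINT x:{S c<..S d}|lborel. u (T x))"
    using mem by (intro set_integral_mono set_integrable_const_Ioc int cINF_lower[OF bdd(1)]) auto
  then show "lower_term u c d \<le> (LINT x:{S c<..S d}|lborel. u (T x))"
    unfolding lower_term_def by (simp add: set_integral_const_levels[OF S])
  have "(LINT x:{S c<..S d}|lborel. u (T x)) \<le> (LINT x:{S c<..S d}|lborel. SUP t\<in>{c..d}. u t)"
    using mem by (intro set_integral_mono set_integrable_const_Ioc int cSUP_upper[OF _ bdd(2)]) auto
  then show "(LINT x:{S c<..S d}|lborel. u (T x)) \<le> upper_term u c d"
    unfolding upper_term_def by (simp add: set_integral_const_levels[OF S])
qed

text \<open>
  The levels between those of two parameters form an interval of Lebesgue measure equal to the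
  increment of \<open>S\<close>, so lower and upper sums are integrals of step functions below and above.
\<close>

lemma integral_levels_between_sums:
  assumes u: "level_measurable u" and cd: "0 \<le> c" and B: "\<And>t. t \<in> {c..d} \<Longrightarrow> \<bar>u t\<bar> \<le> B"
    and z: "subdivision c d z"
  shows "path_sum (lower_term u) z \<le> (LINT x:{S c<..S d}|lborel. u (T x))"
    and "(LINT x:{S c<..S d}|lborel. u (T x)) \<le> path_sum (upper_term u) z"
proof -
  define G where "G y = (LINT x:{S c<..S y}|lborel. u (T x))" for y
  have G_diff: "G y - G x = (LINT x:{S x<..S y}|lborel. u (T x))" if "c \<le> x" "x < y" "y \<le> d" for x y
  proof -
    have "{S c<..S y} = {S c<..S x} \<union> {S x<..S y}"
      using S_le_iff[of c x] S_le_iff[of x y] that cd by auto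
    moreover have "set_integrable lborel {S c<..S x} (\<lambda>x. u (T x))"
      "set_integrable lborel {S x<..S y} (\<lambda>x. u (T x))"
      using that cd B by (auto intro!: set_integrable_levels[OF u, where B = B])
    ultimately show ?thesis
      unfolding G_def by (simp add: set_integral_Un)
  qed
  have G_c: "G c = 0"
    by (simp add: G_def set_lebesgue_integral_def)
  have "path_sum (lower_term u) z \<le> G d - G c"
  proof (rule path_sum_le_telescope[OF z])
    show "lower_term u x y \<le> G y - G x" if "c \<le> x" "x < y" "y \<le> d" for x y
      unfolding G_diff[OF that] using that cd B by (intro integral_levels_between(1)[OF u, where B = B]) auto
  qed
  then show "path_sum (lower_term u) z \<le> (LINT x:{S c<..S d}|lborel. u (T x))"
    unfolding G_c by (simp add: G_def)
  have "G d - G c \<le> path_sum (upper_term u) z"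
  proof (rule path_sum_ge_telescope[OF z])
    show "G y - G x \<le> upper_term u x y" if "c \<le> x" "x < y" "y \<le> d" for x y
      unfolding G_diff[OF that] using that cd B by (intro integral_levels_between(2)[OF u, where B = B]) auto
  qed
  then show "(LINT x:{S c<..S d}|lborel. u (T x)) \<le> path_sum (upper_term u) z"
    unfolding G_c by (simp add: G_def)
qed

lemma ex_subdivision: "c \<le> d \<Longrightarrow> {z. subdivision c d z} \<noteq> {}"
proof -
  assume "c \<le> d"
  then have "subdivision c d (if c = d then [c] else [c, d])"
    by (auto simp: subdivision_def)
  then show ?thesis by blast
qed

lemma integral_between_F_integrals:
  assumes u: "level_measurable (\<lambda>t. h (v t))" and cd: "0 \<le> c" "c \<le> d"
    and B: "\<And>t. t \<in> {c..d} \<Longrightarrow> \<bar>h (v t)\<bar> \<le> B"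
  shows "lower_F_integral v \<alpha> h c d \<le> (LINT x:{S c<..S d}|lborel. h (v (T x)))"
    and "(LINT x:{S c<..S d}|lborel. h (v (T x))) \<le> upper_F_integral v \<alpha> h c d"
  unfolding lower_F_integral_eq[OF cd(1)] upper_F_integral_eq[OF cd(1)]
  using integral_levels_between_sums[OF u cd(1) B]
  by (intro cSUP_least cINF_greatest ex_subdivision cd(2); simp)+

lemma has_proper_F_integralD:
  assumes u: "level_measurable (\<lambda>t. h (v t))" and c: "0 \<le> c" and h: "has_proper_F_integral v \<alpha> h c d I"
  shows "set_integrable lborel {S c<..S d} (\<lambda>x. h (v (T x)))"
    and "I = (LINT x:{S c<..S d}|lborel. h (v (T x)))"
proof -
  have cd: "c \<le> d"
    using h by (simp add: has_proper_F_integral_def)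
  have "bounded (h ` v ` {c..d})"
    using h by (simp add: has_proper_F_integral_def curve_section_def)
  then obtain B where "\<forall>t\<in>{c..d}. \<bar>h (v t)\<bar> \<le> B"
    unfolding bounded_iff by auto
  then have B: "\<And>t. t \<in> {c..d} \<Longrightarrow> \<bar>h (v t)\<bar> \<le> B"
    by blast
  show "set_integrable lborel {S c<..S d} (\<lambda>x. h (v (T x)))"
    by (rule set_integrable_levels[OF u c cd B])
  show "I = (LINT x:{S c<..S d}|lborel. h (v (T x)))"
    using integral_between_F_integrals[OF u c cd B] h by (simp add: has_proper_F_integral_def)
qed

text \<open>
  Lower and upper sums bracket the Lebesgue integral, and they come arbitrarily close together.
\<close>

lemma has_proper_F_integralI:
  assumes u: "level_measurable (\<lambda>t. h (v t))" and osl: "one_sided_limits (\<lambda>t. h (v t)) a b"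
    and cd: "0 \<le> a" "a < c" "c \<le> d" "ereal d < b"
  shows "has_proper_F_integral v \<alpha> h c d (LINT x:{S c<..S d}|lborel. h (v (T x)))"
proof -
  let ?u = "\<lambda>t. h (v t)" and ?I = "LINT x:{S c<..S d}|lborel. h (v (T x))"
  let ?L = "lower_F_integral v \<alpha> h c d" and ?U = "upper_F_integral v \<alpha> h c d"
  have c: "0 \<le> c"
    using cd by simp
  obtain B where B: "\<And>t. t \<in> {c..d} \<Longrightarrow> \<bar>?u t\<bar> \<le> B"
    using one_sided_limits_bounded[OF osl cd(2-4)] by blast
  have bdd: "bdd_above (path_sum (lower_term ?u) ` {z. subdivision c d z})"
    "bdd_below (path_sum (upper_term ?u) ` {z. subdivision c d z})"
    using integral_levels_between_sums[OF u c B]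
    by (auto intro!: bdd_aboveI2[of _ _ ?I] bdd_belowI2[of _ ?I])
  have "?U - ?L \<le> \<epsilon>" if eps: "\<epsilon> > 0" for \<epsilon>
  proof -
    have pos: "1 + (S d - S c) > 0"
      using S_le_iff[of c d] c cd(3) by simp
    obtain z where z: "subdivision c d z"
      "path_sum (\<lambda>x y. upper_term ?u x y - lower_term ?u x y) z \<le> \<epsilon> / (1 + (S d - S c)) * (S d - S c)"
      using ex_fine_subdivision[OF osl cd divide_pos_pos[OF eps pos]] by blast
    have "?U \<le> path_sum (upper_term ?u) z" "path_sum (lower_term ?u) z \<le> ?L"
      unfolding lower_F_integral_eq[OF c] upper_F_integral_eq[OF c]
      using z by (auto intro!: cINF_lower[OF bdd(2)] cSUP_upper[OF _ bdd(1)])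
    then have "?U - ?L \<le> \<epsilon> / (1 + (S d - S c)) * (S d - S c)"
      using z(2) by (simp add: path_sum_diff)
    also have "\<dots> \<le> \<epsilon>"
      using eps pos by (simp add: field_simps)
    finally show ?thesis .
  qed
  then have "?U - ?L \<le> 0"
    using field_le_epsilon[of "?U - ?L" 0] by simp
  then have "?L = ?I" "?U = ?I"
    using integral_between_F_integrals[OF u c cd(3) B] by auto
  moreover have "bounded (h ` curve_section v c d)"
    unfolding bounded_iff curve_section_def using B by (auto intro!: exI[of _ B])
  ultimately show ?thesis
    using cd(3) by (simp add: has_proper_F_integral_def)
qed

definition level_range :: "real \<Rightarrow> ereal \<Rightarrow> real set" where
  "level_range a b = {x. S a < x \<and> ereal (T x) < b}"

lemma level_range_ereal: "0 \<le> a \<Longrightarrow> 0 \<le> d \<Longrightarrow> level_range a (ereal d) = {S a<..<S d}"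
  and level_range_infinity: "level_range a \<infinity> = {S a<..}"
  unfolding level_range_def using S_nonneg[of a] by (auto simp: T_less_iff)

lemma level_range_sets [measurable]: "0 \<le> a \<Longrightarrow> ereal a < b \<Longrightarrow> level_range a b \<in> sets borel"
  by (cases b) (auto simp: level_range_ereal level_range_infinity)

lemma set_integral_vanishing_parts:
  fixes H :: "real \<Rightarrow> real"
  assumes H: "set_integrable lborel E H" and A: "\<And>n. A n \<inter> E \<in> sets borel"
    and ev: "\<And>x. x \<in> E \<Longrightarrow> eventually (\<lambda>n. x \<notin> A n) sequentially"
  shows "(\<lambda>n. LINT x:A n \<inter> E|lborel. H x) \<longlonglongrightarrow> 0"
proof -
  have "(\<lambda>n. LINT x|lborel. indicator (A n \<inter> E) x *\<^sub>R H x) \<longlonglongrightarrow> (LINT x::real|lborel. 0)"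
  proof (rule integral_dominated_convergence)
    show "integrable lborel (\<lambda>x. norm (indicator E x *\<^sub>R H x))"
      using H unfolding set_integrable_def by (rule integrable_norm)
    show "(\<lambda>x. indicator (A n \<inter> E) x *\<^sub>R H x) \<in> borel_measurable lborel" for n
      using set_integrable_subset[OF H, of "A n \<inter> E"] A by (auto simp: set_integrable_def)
    show "AE x in lborel. (\<lambda>n. indicator (A n \<inter> E) x *\<^sub>R H x) \<longlonglongrightarrow> 0"
    proof (intro AE_I2)
      fix x
      show "(\<lambda>n. indicator (A n \<inter> E) x *\<^sub>R H x) \<longlonglongrightarrow> 0"
      proof (cases "x \<in> E")
        case True
        then show ?thesis
          using ev[OF True] by (intro tendsto_eventually) (auto elim!: eventually_mono)
      qed simp
    qed
    show "AE x in lborel. norm (indicator (A n \<inter> E) x *\<^sub>R H x) \<le> norm (indicator E x *\<^sub>R H x)" for n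
      by (intro AE_I2) (auto split: split_indicator)
  qed simp
  then show ?thesis
    by (simp add: set_lebesgue_integral_def)
qed

lemma eventually_inner_ends:
  assumes "ereal a < b"
  shows "eventually (\<lambda>(c, d). a < c \<and> c \<le> d \<and> ereal d < b) (inner_ends a b)"
proof -
  obtain m where m: "ereal a < ereal m" "ereal m < b"
    using ereal_dense2[OF assms] by blast
  have "eventually (\<lambda>c. a < c \<and> c < m) (at_right a)"
    using eventually_at_right_real[of a m] m by simp
  moreover have "eventually (\<lambda>d. m < d \<and> ereal d < b) (if b = \<infinity> then at_top else at_left (real_of_ereal b))"
  proof (cases b)
    case (real r)
    then show ?thesis
      using eventually_at_left_real[of m r] m by simp
  qed (use m in \<open>auto simp: eventually_gt_at_top\<close>)
  ultimately have "eventually (\<lambda>x. (a < fst x \<and> fst x < m) \<and> (m < snd x \<and> ereal (snd x) < b)) (inner_ends a b)"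
    unfolding inner_ends_def by (rule eventually_prodI)
  then show ?thesis
    by (rule eventually_mono) auto
qed

lemma inner_ends_neq_bot: "inner_ends a b \<noteq> bot"
  by (simp add: inner_ends_def prod_filter_eq_bot trivial_limit_at_right_real trivial_limit_at_left_real)

text \<open>
  The two ends move independently, so the integrals over the two missing tails are shown to vanish
  separately.
\<close>

lemma tendsto_integral_inner_ends:
  fixes H :: "real \<Rightarrow> real"
  assumes H: "set_integrable lborel (level_range a b) H" and ab: "0 \<le> a" "ereal a < b"
  shows "((\<lambda>(c, d). LINT x:{S c<..S d}|lborel. H x) \<longlongrightarrow> (LINT x:level_range a b|lborel. H x)) (inner_ends a b)"
proof -
  let ?E = "level_range a b"
  let ?I = "LINT x:?E|lborel. H x"
  let ?A = "\<lambda>c. LINT x:{..S c} \<inter> ?E|lborel. H x" and ?B = "\<lambda>d. LINT x:{S d<..} \<inter> ?E|lborel. H x"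
  note [measurable] = level_range_sets[OF ab]
  have E: "x \<ge> 0" "a < T x" "ereal (T x) < b" if "x \<in> ?E" for x
    using that S_nonneg[OF ab(1)] less_T_iff[of x a] ab unfolding level_range_def by auto
  have A: "(?A \<longlongrightarrow> 0) (at_right a)"
  proof (rule tendsto_at_right_sequentially[of a "a + 1"])
    fix X assume X: "\<And>n. a < X n" "X \<longlonglongrightarrow> a"
    show "(\<lambda>n. ?A (X n)) \<longlonglongrightarrow> 0"
    proof (rule set_integral_vanishing_parts[OF H])
      fix x assume x: "x \<in> ?E"
      have "eventually (\<lambda>n. X n < T x) sequentially"
        using E[OF x] by (intro order_tendstoD(2)[OF X(2)])
      then show "eventually (\<lambda>n. x \<notin> {..S (X n)}) sequentially"
      proof (rule eventually_mono)
        fix n assume "X n < T x"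
        then show "x \<notin> {..S (X n)}"
          using less_T_iff[of x "X n"] E[OF x] X(1)[of n] ab(1) by simp
      qed
    qed auto
  qed simp
  have B_seq: "(\<lambda>n. ?B (X n)) \<longlonglongrightarrow> 0"
    if X: "\<And>t. t < b \<Longrightarrow> eventually (\<lambda>n. t < ereal (X n)) sequentially" for X
  proof (rule set_integral_vanishing_parts[OF H])
    fix x assume x: "x \<in> ?E"
    have "eventually (\<lambda>n. T x < X n) sequentially"
      using X[OF E(3)[OF x]] by simp
    then show "eventually (\<lambda>n. x \<notin> {S (X n)<..}) sequentially"
    proof (rule eventually_mono)
      fix n assume "T x < X n"
      then show "x \<notin> {S (X n)<..}"
        using T_less_iff[of x "X n"] E[OF x] ab(1) by simp
    qed
  qed auto
  have B: "(?B \<longlongrightarrow> 0) (if b = \<infinity> then at_top else at_left (real_of_ereal b))"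
  proof (cases b)
    case (real r)
    have "(?B \<longlongrightarrow> 0) (at_left r)"
    proof (rule tendsto_at_left_sequentially[of a])
      fix X assume X: "X \<longlonglongrightarrow> r"
      show "(\<lambda>n. ?B (X n)) \<longlonglongrightarrow> 0"
      proof (rule B_seq)
        fix t assume "t < b"
        moreover have "(\<lambda>n. ereal (X n)) \<longlonglongrightarrow> b"
          using X real by simp
        ultimately show "eventually (\<lambda>n. t < ereal (X n)) sequentially"
          by (intro order_tendstoD(1))
      qed
    qed (use ab real in auto)
    then show ?thesis
      using real by simp
  next
    case PInf
    have "(?B \<longlongrightarrow> 0) at_top"
    proof (rule tendsto_at_topI_sequentially)
      fix X :: "nat \<Rightarrow> real" assume X: "filterlim X at_top sequentially"
      show "(\<lambda>n. ?B (X n)) \<longlonglongrightarrow> 0"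
      proof (rule B_seq)
        fix t assume "t < b"
        moreover have "(\<lambda>n. ereal (X n)) \<longlonglongrightarrow> b"
          using X PInf tendsto_PInfty_eq_at_top by auto
        ultimately show "eventually (\<lambda>n. t < ereal (X n)) sequentially"
          by (intro order_tendstoD(1))
      qed
    qed
    then show ?thesis
      using PInf by simp
  qed (use ab in auto)
  have "((\<lambda>x. ?I - ?A (fst x) - ?B (snd x)) \<longlongrightarrow> ?I - 0 - 0) (inner_ends a b)"
    unfolding inner_ends_def
    by (intro tendsto_diff tendsto_const filterlim_compose[OF A filterlim_fst] filterlim_compose[OF B filterlim_snd])
  moreover have "eventually (\<lambda>x. ?I - ?A (fst x) - ?B (snd x) = (case x of (c, d) \<Rightarrow> LINT x:{S c<..S d}|lborel. H x))
      (inner_ends a b)"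
    using eventually_inner_ends[OF ab(2)]
  proof (rule eventually_mono, clarify)
    fix c d assume cd: "a < c" "c \<le> d" "ereal d < b"
    have S: "S c \<le> S d" "S a < S c"
      using cd ab S_le_iff[of c d] S_less_iff[of a c] by auto
    have sub: "{S c<..S d} \<subseteq> ?E"
    proof
      fix x assume x: "x \<in> {S c<..S d}"
      then have "T x \<le> d"
        using T_mem[of c d x] cd ab by auto
      then have "ereal (T x) < b"
        using cd(3) by (meson ereal_less_eq(3) le_less_trans)
      then show "x \<in> ?E"
        using x S by (auto simp: level_range_def)
    qed
    have *: "?E = ({..S c} \<inter> ?E) \<union> ({S c<..S d} \<union> ({S d<..} \<inter> ?E))"
      using sub by auto
    have int: "set_integrable lborel ({..S c} \<inter> ?E) H" "set_integrable lborel {S c<..S d} H"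
      "set_integrable lborel ({S d<..} \<inter> ?E) H" "set_integrable lborel ({S c<..S d} \<union> ({S d<..} \<inter> ?E)) H"
      using sub by (auto intro!: set_integrable_subset[OF H])
    have "?I = ?A c + ((LINT x:{S c<..S d}|lborel. H x) + ?B d)"
    proof -
      have disj: "({..S c} \<inter> ?E) \<inter> ({S c<..S d} \<union> ({S d<..} \<inter> ?E)) = {}"
        "{S c<..S d} \<inter> ({S d<..} \<inter> ?E) = {}"
        using S by auto
      have "?I = (LINT x:({..S c} \<inter> ?E) \<union> ({S c<..S d} \<union> ({S d<..} \<inter> ?E))|lborel. H x)"
        using * by (rule arg_cong)
      also have "\<dots> = ?A c + (LINT x:{S c<..S d} \<union> ({S d<..} \<inter> ?E)|lborel. H x)"
        by (rule set_integral_Un[OF disj(1) int(1,4)])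
      finally show ?thesis
        by (simp only: set_integral_Un[OF disj(2) int(2,3)])
    qed
    then show "?I - ?A (fst (c, d)) - ?B (snd (c, d)) = (LINT x:{S c<..S d}|lborel. H x)"
      by simp
  qed
  ultimately show ?thesis
    by (auto intro: Lim_transform_eventually)
qed

text \<open>
  From left to right, the convergence of the integrals of \<open>\<bar>h\<bar>\<close> along one exhausting sequence of
  sections gives integrability by monotone convergence; from right to left, dominated convergence.
\<close>

lemma has_improper_F_integral_iff:
  assumes u: "level_measurable (\<lambda>t. h (v t))" and osl: "one_sided_limits (\<lambda>t. h (v t)) a b"
    and ab: "0 \<le> a" "ereal a < b"
  shows "has_improper_F_integral v \<alpha> h a b I \<longleftrightarrow>
    set_integrable lborel (level_range a b) (\<lambda>x. h (v (T x))) \<and>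
    I = (LINT x:level_range a b|lborel. h (v (T x)))"
proof -
  let ?E = "level_range a b" and ?H = "\<lambda>x. h (v (T x))"
  note [measurable] = level_range_sets[OF ab]
  have u_abs: "level_measurable (\<lambda>t. \<bar>h (v t)\<bar>)"
    using borel_measurable_abs[OF u[unfolded set_borel_measurable_def]]
    by (simp add: set_borel_measurable_def abs_mult)
  have osl_abs: "one_sided_limits (\<lambda>t. \<bar>h (v t)\<bar>) a b"
    using one_sided_limits_compose[OF osl, of abs] continuous_on_rabs[OF continuous_on_id] by simp
  have E_pos: "?E \<subseteq> {0<..}"
    using S_nonneg[OF ab(1)] by (auto simp: level_range_def)
  have lower: "lower_F_integral v \<alpha> h c d = (LINT x:{S c<..S d}|lborel. ?H x)"
    and lower_abs: "lower_F_integral v \<alpha> (\<lambda>\<theta>. \<bar>h \<theta>\<bar>) c d = (LINT x:{S c<..S d}|lborel. \<bar>?H x\<bar>)"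
    if "a < c" "c \<le> d" "ereal d < b" for c d
    using has_proper_F_integralI[OF u osl ab(1) that] has_proper_F_integralI[OF u_abs osl_abs ab(1) that]
    by (simp_all add: has_proper_F_integral_def)
  have lim: "((\<lambda>(c, d). lower_F_integral v \<alpha> h c d) \<longlongrightarrow> L) (inner_ends a b) \<longleftrightarrow>
      ((\<lambda>(c, d). LINT x:{S c<..S d}|lborel. ?H x) \<longlongrightarrow> L) (inner_ends a b)" for L
    using lower by (intro tendsto_cong eventually_mono[OF eventually_inner_ends[OF ab(2)]]) auto
  have lim_abs: "((\<lambda>(c, d). lower_F_integral v \<alpha> (\<lambda>\<theta>. \<bar>h \<theta>\<bar>) c d) \<longlongrightarrow> L) (inner_ends a b) \<longleftrightarrow>
      ((\<lambda>(c, d). LINT x:{S c<..S d}|lborel. \<bar>?H x\<bar>) \<longlongrightarrow> L) (inner_ends a b)" for L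
    using lower_abs by (intro tendsto_cong eventually_mono[OF eventually_inner_ends[OF ab(2)]]) auto
  have proper: "\<exists>K. has_proper_F_integral v \<alpha> h c d K" if "a < c" "c \<le> d" "ereal d < b" for c d
    using has_proper_F_integralI[OF u osl ab(1) that] by blast
  have integrable: "set_integrable lborel ?E ?H"
    if K: "((\<lambda>(c, d). LINT x:{S c<..S d}|lborel. \<bar>?H x\<bar>) \<longlongrightarrow> K) (inner_ends a b)" for K
  proof -
    obtain q p :: "nat \<Rightarrow> real" where mono: "incseq q" "decseq p" and pq: "\<And>n. p n < q n"
      and a_p: "\<And>n. ereal a < ereal (p n)" and q_b: "\<And>n. ereal (q n) < b"
      and p_lim: "(\<lambda>n. ereal (p n)) \<longlonglongrightarrow> ereal a" and q_lim: "(\<lambda>n. ereal (q n)) \<longlonglongrightarrow> b"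
      by (rule einterval_Icc_approximation[OF ab(2)]) (rule that)
    have a_p: "a < p n" for n
      using a_p[of n] by simp
    have "filterlim p (at_right a) sequentially"
      using p_lim a_p less_imp_neq[OF a_p, THEN not_sym] by (simp add: filterlim_at)
    moreover have "filterlim q (if b = \<infinity> then at_top else at_left (real_of_ereal b)) sequentially"
    proof (cases b)
      case (real r)
      then show ?thesis
        using q_lim q_b less_imp_neq[OF q_b] by (simp add: filterlim_at)
    qed (use q_lim ab in \<open>auto simp: tendsto_PInfty_eq_at_top\<close>)
    ultimately have "filterlim (\<lambda>n. (p n, q n)) (inner_ends a b) sequentially"
      unfolding inner_ends_def by (rule filterlim_Pair)
    from filterlim_compose[OF K this]
    have K_seq: "(\<lambda>n. LINT x:{S (p n)<..S (q n)}|lborel. \<bar>?H x\<bar>) \<longlonglongrightarrow> K"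
      by simp
    have pos: "0 \<le> p n" "0 \<le> q n" for n
      using ab pq[of n] a_p[of n] by auto
    have "integrable lborel (\<lambda>x. indicator ?E x *\<^sub>R \<bar>?H x\<bar>)"
    proof (rule integrable_monotone_convergence)
      show "integrable lborel (\<lambda>x. indicator {S (p n)<..S (q n)} x *\<^sub>R \<bar>?H x\<bar>)" for n
        using has_proper_F_integralD(1)[OF u_abs pos(1)[of n]
            has_proper_F_integralI[OF u_abs osl_abs ab(1) a_p[of n] less_imp_le[OF pq[of n]] q_b[of n]]]
        by (simp add: set_integrable_def)
      show "AE x in lborel. mono (\<lambda>n. indicator {S (p n)<..S (q n)} x *\<^sub>R \<bar>?H x\<bar>)"
      proof (intro AE_I2 monoI)
        fix x and m n :: nat assume "m \<le> n"
        then have "S (p n) \<le> S (p m)" "S (q m) \<le> S (q n)"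
          using mono pos by (auto simp: S_le_iff incseq_def decseq_def)
        then show "indicator {S (p m)<..S (q m)} x *\<^sub>R \<bar>?H x\<bar> \<le> indicator {S (p n)<..S (q n)} x *\<^sub>R \<bar>?H x\<bar>"
          by (auto split: split_indicator)
      qed
      show "AE x in lborel. (\<lambda>n. indicator {S (p n)<..S (q n)} x *\<^sub>R \<bar>?H x\<bar>) \<longlonglongrightarrow> indicator ?E x *\<^sub>R \<bar>?H x\<bar>"
      proof (intro AE_I2)
        fix x
        show "(\<lambda>n. indicator {S (p n)<..S (q n)} x *\<^sub>R \<bar>?H x\<bar>) \<longlonglongrightarrow> indicator ?E x *\<^sub>R \<bar>?H x\<bar>"
        proof (cases "x \<in> ?E")
          case True
          then have x: "x \<ge> 0" "a < T x" "ereal (T x) < b"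
            using S_nonneg[OF ab(1)] less_T_iff[of x a] ab unfolding level_range_def by auto
          have "eventually (\<lambda>n. p n < T x) sequentially"
            using order_tendstoD(2)[OF p_lim, of "ereal (T x)"] x by simp
          moreover have "eventually (\<lambda>n. T x < q n) sequentially"
            using order_tendstoD(1)[OF q_lim x(3)] by simp
          ultimately have "eventually (\<lambda>n. x \<in> {S (p n)<..S (q n)}) sequentially"
            by eventually_elim (use x pos less_T_iff T_less_iff in \<open>auto simp: less_imp_le\<close>)
          then have "eventually (\<lambda>n. indicator {S (p n)<..S (q n)} x *\<^sub>R \<bar>?H x\<bar> = indicator ?E x *\<^sub>R \<bar>?H x\<bar>) sequentially"
            by (rule eventually_mono) (use True in auto)
          then show ?thesis
            by (rule tendsto_eventually)
        next
          case False
          have "x \<notin> {S (p n)<..S (q n)}" for n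
          proof
            assume x: "x \<in> {S (p n)<..S (q n)}"
            have "S a < S (p n)"
              using S_less_iff[of a "p n"] pos ab a_p[of n] by simp
            moreover have "ereal (T x) < b"
              using T_mem[OF pos(1) pos(2) x] q_b[of n] by (meson ereal_less_eq(3) le_less_trans)
            ultimately show False
              using False x by (auto simp: level_range_def)
          qed
          then show ?thesis
            using False by simp
        qed
      qed
      show "(\<lambda>n. LINT x|lborel. indicator {S (p n)<..S (q n)} x *\<^sub>R \<bar>?H x\<bar>) \<longlonglongrightarrow> K"
        using K_seq by (simp add: set_lebesgue_integral_def)
      show "(\<lambda>x. indicator ?E x *\<^sub>R \<bar>?H x\<bar>) \<in> borel_measurable lborel"
        using set_borel_measurable_subset[OF u_abs _ E_pos] by (simp add: set_borel_measurable_def)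
    qed
    then have "set_integrable lborel ?E (\<lambda>x. \<bar>?H x\<bar>)"
      by (simp add: set_integrable_def)
    then show ?thesis
    proof (rule set_integrable_bound)
      show "set_borel_measurable lborel ?E ?H"
        using set_borel_measurable_subset[OF u _ E_pos] by simp
    qed simp
  qed
  show ?thesis
  proof
    assume "has_improper_F_integral v \<alpha> h a b I"
    then obtain K where K: "((\<lambda>(c, d). LINT x:{S c<..S d}|lborel. \<bar>?H x\<bar>) \<longlongrightarrow> K) (inner_ends a b)"
      and I: "((\<lambda>(c, d). LINT x:{S c<..S d}|lborel. ?H x) \<longlongrightarrow> I) (inner_ends a b)"
      unfolding has_improper_F_integral_def lim lim_abs by blast
    show "set_integrable lborel ?E ?H \<and> I = (LINT x:?E|lborel. ?H x)"
      using integrable[OF K] tendsto_unique[OF inner_ends_neq_bot I tendsto_integral_inner_ends[OF integrable[OF K] ab]]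
      by blast
  next
    assume H: "set_integrable lborel ?E ?H \<and> I = (LINT x:?E|lborel. ?H x)"
    then have "set_integrable lborel ?E (\<lambda>x. \<bar>?H x\<bar>)"
      by (simp add: set_integrable_abs)
    then show "has_improper_F_integral v \<alpha> h a b I"
      unfolding has_improper_F_integral_def lim lim_abs
      using H proper ab(2) tendsto_integral_inner_ends[OF _ ab] by blast
  qed
qed

lemma has_F_integral_iff:
  assumes u: "level_measurable (\<lambda>t. h (v t))" and osl: "one_sided_limits (\<lambda>t. h (v t)) a b"
    and ab: "0 \<le> a" "ereal a < b"
  shows "has_F_integral v \<alpha> h a b I \<longleftrightarrow>
    set_integrable lborel (level_range a b) (\<lambda>x. h (v (T x))) \<and>
    I = (LINT x:level_range a b|lborel. h (v (T x)))"
proof -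
  have "set_integrable lborel (level_range a b) (\<lambda>x. h (v (T x))) \<and>
    I = (LINT x:level_range a b|lborel. h (v (T x)))"
    if b: "b = ereal d" and h: "has_proper_F_integral v \<alpha> h a d I" for d
  proof -
    have "d \<ge> 0"
      using ab b by simp
    then have E: "level_range a b = {S a<..<S d}"
      using ab b level_range_ereal by simp
    have diff: "({S a<..S d} - {S a<..<S d}) \<union> ({S a<..<S d} - {S a<..S d}) \<subseteq> {S d}"
      by auto
    show ?thesis
      using has_proper_F_integralD[OF u ab(1) h] unfolding E
      using set_integrable_discrete_difference[OF _ diff, of lborel "\<lambda>x. h (v (T x))"]
        set_integral_discrete_difference[OF _ diff, of lborel "\<lambda>x. h (v (T x))"] by simp
  qed
  then show ?thesis
    unfolding has_F_integral_def has_improper_F_integral_iff[OF assms] by blast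
qed

text \<open>
  The value is defined as the unique \<open>I\<close> for which the integral relation holds; uniqueness comes from
  the characterization by the Lebesgue integral.
\<close>

lemma F_integral_eq_integral:
  assumes u: "level_measurable (\<lambda>t. h (v t))" and osl: "one_sided_limits (\<lambda>t. h (v t)) a b"
    and ab: "0 \<le> a" "ereal a < b"
  shows "F_integrable v \<alpha> h a b \<longleftrightarrow> set_integrable lborel (level_range a b) (\<lambda>x. h (v (T x)))"
    and "F_integrable v \<alpha> h a b \<Longrightarrow> F_integral v \<alpha> h a b = (LINT x:level_range a b|lborel. h (v (T x)))"
  unfolding F_integrable_def F_integral_def has_F_integral_iff[OF assms] by auto

end

section \<open>Piecewise continuous functions along the curve\<close>

context fractal_curve_param
begin

text \<open>
  The limits in the definition of piecewise continuity run over points of the curve. Injectivity of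
  \<open>v\<close> keeps \<open>v x\<close> away from the limit point \<open>v t\<close>.
\<close>

lemma tendsto_along_curve:
  assumes pq: "0 < t" "t \<in> {p..q}" "0 \<le> p" and ev: "eventually (\<lambda>x. x \<in> {p<..<q}) (at t within A)"
    and f: "(f \<longlongrightarrow> l) (at (v t) within v ` {p<..<q})"
  shows "((\<lambda>x. f (v x)) \<longlongrightarrow> l) (at t within A)"
proof -
  have "(v \<longlongrightarrow> v t) (at t within A)"
    using isCont_v[OF pq(1)] by (metis isContD tendsto_within_subset subset_UNIV)
  moreover have "eventually (\<lambda>x. v x \<in> v ` {p<..<q} \<and> v x \<noteq> v t) (at t within A)"
  proof -
    have "v x \<noteq> v t" if "x \<in> {p<..<q}" "x \<noteq> t" for x
      using curve_param_v[of x] curve_param_v[of t] that pq by auto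
    then show ?thesis
      using ev eventually_at_topological
      by (auto simp: eventually_at_filter elim!: eventually_mono)
  qed
  ultimately have "filterlim v (at (v t) within v ` {p<..<q}) (at t within A)"
    by (simp add: filterlim_at)
  then show ?thesis
    using f by (rule filterlim_compose[rotated])
qed

lemma piecewise_continuous_section_limits:
  assumes pw: "piecewise_continuous_section v f a b" and a: "0 \<le> a"
  shows "one_sided_limits (\<lambda>t. f (v t)) a (ereal b)"
    and "finite {t. a < t \<and> t < b \<and> \<not> isCont (\<lambda>t. f (v t)) t}"
proof -
  obtain z where z: "subdivision a b z"
    and cont: "\<And>i. i < length z - 1 \<Longrightarrow> continuous_on (v ` {z ! i<..<z ! Suc i}) f"
    and left_end: "\<And>i. i < length z - 1 \<Longrightarrow> \<exists>l. (f \<longlongrightarrow> l) (at (v (z ! i)) within v ` {z ! i<..<z ! Suc i})"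
    and right_end: "\<And>i. i < length z - 1 \<Longrightarrow> \<exists>r. (f \<longlongrightarrow> r) (at (v (z ! Suc i)) within v ` {z ! i<..<z ! Suc i})"
    using pw unfolding piecewise_continuous_section_def Let_def by blast
  have nonneg: "0 \<le> z ! i" if "i < length z" for i
    using subdivision_mem[OF z nth_mem[OF that]] a by simp
  have inner: "isCont (\<lambda>t. f (v t)) t" if i: "i < length z - 1" and t: "z ! i < t" "t < z ! Suc i" for i t
  proof -
    have "0 \<le> z ! i"
      using nonneg[of i] i by simp
    then have "continuous_on {z ! i<..<z ! Suc i} (\<lambda>t. f (v t))"
      by (intro continuous_on_compose2[OF cont[OF i]] continuous_on_subset[OF v_continuous]) auto
    then show ?thesis
      using t by (simp add: continuous_on_eq_continuous_at)
  qed
  show "one_sided_limits (\<lambda>t. f (v t)) a (ereal b)"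
    unfolding one_sided_limits_def
  proof (intro allI impI conjI)
    fix t assume "a < t" "ereal t < ereal b"
    then have t: "a < t" "t < b" "0 < t"
      using a by auto
    obtain i where i: "i < length z - 1" "z ! i < t" "t \<le> z ! Suc i"
      using subdivision_locate'[OF z t(1)] t by auto
    have ev: "eventually (\<lambda>x. x \<in> {z ! i<..<z ! Suc i}) (at_left t)"
      using eventually_at_left_real[OF i(2)] by (rule eventually_mono) (use i in auto)
    show "\<exists>l. ((\<lambda>t. f (v t)) \<longlongrightarrow> l) (at_left t)"
    proof (cases "t = z ! Suc i")
      case True
      obtain r where "(f \<longlongrightarrow> r) (at (v t) within v ` {z ! i<..<z ! Suc i})"
        using right_end[OF i(1)] True by auto
      then show ?thesis
        using tendsto_along_curve[OF t(3) _ _ ev] i nonneg[of i] by auto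
    next
      case False
      then show ?thesis
        using inner[OF i(1,2)] i(3) by (auto simp: isCont_def filterlim_at_split)
    qed
    obtain i where i: "i < length z - 1" "z ! i \<le> t" "t < z ! Suc i"
      using subdivision_locate[OF z _ t(2)] t by auto
    have ev: "eventually (\<lambda>x. x \<in> {z ! i<..<z ! Suc i}) (at_right t)"
      using eventually_at_right_real[OF i(3)] by (rule eventually_mono) (use i in auto)
    show "\<exists>r. ((\<lambda>t. f (v t)) \<longlongrightarrow> r) (at_right t)"
    proof (cases "t = z ! i")
      case True
      obtain r where "(f \<longlongrightarrow> r) (at (v t) within v ` {z ! i<..<z ! Suc i})"
        using left_end[OF i(1)] True by auto
      then show ?thesis
        using tendsto_along_curve[OF t(3) _ _ ev] i nonneg[of i] by auto
    next
      case False
      then show ?thesis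
        using inner[OF i(1) _ i(3)] i(2) by (auto simp: isCont_def filterlim_at_split)
    qed
  qed
  have "{t. a < t \<and> t < b \<and> \<not> isCont (\<lambda>t. f (v t)) t} \<subseteq> set z"
  proof clarify
    fix t assume t: "a < t" "t < b" "\<not> isCont (\<lambda>t. f (v t)) t"
    obtain i where i: "i < length z - 1" "z ! i \<le> t" "t < z ! Suc i"
      using subdivision_locate[OF z _ t(2)] t by auto
    have "t = z ! i"
      using inner[OF i(1) _ i(3)] t(3) i(2) by force
    then show "t \<in> set z"
      using i by auto
  qed
  then show "finite {t. a < t \<and> t < b \<and> \<not> isCont (\<lambda>t. f (v t)) t}"
    by (rule finite_subset) simp
qed

text \<open>
  As a function of the level, \<open>f\<close> is continuous outside a countable set, because the half-line is
  exhausted by countably many closed sections, each with finitely many break points.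
\<close>

lemma piecewise_continuous_levels:
  fixes f :: "real ^ 'd \<Rightarrow> complex"
  assumes pw: "\<And>a b. 0 < a \<Longrightarrow> a < b \<Longrightarrow> piecewise_continuous_section v f a b"
  shows "one_sided_limits (\<lambda>t. f (v t)) 0 \<infinity>"
    and "(\<lambda>x. if x > 0 then f (v (T x)) else 0) \<in> borel_measurable borel"
proof -
  show "one_sided_limits (\<lambda>t. f (v t)) 0 \<infinity>"
    unfolding one_sided_limits_def
  proof (intro allI impI)
    fix t :: real assume "0 < t"
    then show "(\<exists>l. ((\<lambda>t. f (v t)) \<longlongrightarrow> l) (at_left t)) \<and> (\<exists>r. ((\<lambda>t. f (v t)) \<longlongrightarrow> r) (at_right t))"
      using piecewise_continuous_section_limits(1)[OF pw[of "t / 2" "2 * t"]]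
      unfolding one_sided_limits_def by simp
  qed
  let ?D = "\<lambda>n::nat. {t. 1 / real (Suc n) < t \<and> t < real (Suc (Suc n)) \<and> \<not> isCont (\<lambda>t. f (v t)) t}"
  define X where "X = insert 0 (S ` (\<Union>n. ?D n))"
  have "finite (?D n)" for n
    by (rule piecewise_continuous_section_limits(2)[OF pw]) (auto intro: order_le_less_trans[of _ 1])
  then have "countable X"
    unfolding X_def by (intro countable_insert countable_image countable_UN) (auto intro: countable_finite)
  moreover have "continuous_on (- X) (\<lambda>x. if x > 0 then f (v (T x)) else 0)"
  proof (intro continuous_at_imp_continuous_on ballI)
    fix x assume x: "x \<in> - X"
    show "isCont (\<lambda>x. if x > 0 then f (v (T x)) else 0) x"
    proof (cases "x > 0")
      case True
      have T: "T x > 0"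
        using less_T_iff[of x 0] True S_0 by simp
      \<comment> \<open>An index \<open>n\<close> whose section \<open>(1/(n+1), n+2)\<close> contains \<open>T x\<close>.\<close>
      obtain m where m: "T x < real m"
        using reals_Archimedean2 by blast
      obtain k where k: "inverse (real (Suc k)) < T x"
        using reals_Archimedean[OF T] by auto
      define n where "n = max m k"
      have "1 / real (Suc n) \<le> inverse (real (Suc k))"
        by (simp add: n_def field_simps)
      then have "1 / real (Suc n) < T x" "T x < real (Suc (Suc n))"
        using m k by (auto simp: n_def)
      moreover have "T x \<notin> ?D n"
      proof
        assume "T x \<in> ?D n"
        then have "S (T x) \<in> X"
          unfolding X_def by blast
        then show False
          using x True S_T[of x] by simp
      qed
      ultimately have "isCont (\<lambda>t. f (v t)) (T x)"
        by blast
      then have "isCont (\<lambda>x. f (v (T x))) x"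
        by (rule isCont_o2[where g = "\<lambda>t. f (v t)", OF isCont_T[OF True]])
      moreover have "eventually (\<lambda>y. y > 0) (nhds x)"
        using True by (rule order_tendstoD(1)[OF filterlim_ident])
      then have "eventually (\<lambda>y. (if y > 0 then f (v (T y)) else 0) = f (v (T y))) (nhds x)"
        by (rule eventually_mono) simp
      ultimately show ?thesis
        using isCont_cong by fast
    next
      case False
      then have "x < 0"
        using x unfolding X_def by auto
      then have "eventually (\<lambda>y. y < 0) (nhds x)"
        by (rule order_tendstoD(2)[OF filterlim_ident])
      then have "eventually (\<lambda>y. (if y > 0 then f (v (T y)) else 0) = 0) (nhds x)"
        by (rule eventually_mono) simp
      then show ?thesis
        by (subst isCont_cong) auto
    qed
  qed
  ultimately show "(\<lambda>x. if x > 0 then f (v (T x)) else 0) \<in> borel_measurable borel"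
    by (rule borel_measurable_continuous_countable_exceptions)
qed

end

section \<open>A pair of polynomials exchanged by fractional integration\<close>

text \<open>
  The coefficients of \<open>(w)\<^sub>N (w-\<beta>)\<^sub>N\<close> in the basis of rising factorials \<open>(w)\<^sub>k\<close>.
\<close>

definition kernel_coeff :: "real \<Rightarrow> nat \<Rightarrow> nat \<Rightarrow> real" where
  "kernel_coeff \<beta> N k =
     (if k < N then 0 else real (N choose (k - N)) * pochhammer (- \<beta> - real N) (2 * N - k))"

text \<open>
  The coefficients of the polynomial that the Weyl fractional integral of order \<open>\<beta>\<close> produces from
  the one with the coefficients \<open>kernel_coeff \<beta> N\<close>, by \<open>weyl_integral_monomial_exp\<close>.
\<close>

definition dual_coeff :: "real \<Rightarrow> nat \<Rightarrow> nat \<Rightarrow> real" where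
  "dual_coeff \<beta> N m = (\<Sum>k\<le>2*N. kernel_coeff \<beta> N k * real (k choose m) * pochhammer \<beta> (k - m))"

text \<open>
  Vandermonde's identity for rising factorials, applied to \<open>w - \<beta> = (w + N) + (- \<beta> - N)\<close> after
  \<open>(w)\<^bsub>N+i\<^esub> = (w)\<^sub>N (w+N)\<^sub>i\<close>.
\<close>

lemma sum_kernel_coeff:
  fixes w :: complex
  shows "(\<Sum>k\<le>2*N. of_real (kernel_coeff \<beta> N k) * pochhammer w k) =
    pochhammer w N * pochhammer (w - of_real \<beta>) N"
proof -
  let ?b = "- of_real \<beta> - of_nat N :: complex"
  have "(\<Sum>k\<le>2*N. of_real (kernel_coeff \<beta> N k) * pochhammer w k) =
      (\<Sum>k\<in>{N..2*N}. of_real (kernel_coeff \<beta> N k) * pochhammer w k)"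
    by (rule sum.mono_neutral_right) (auto simp: kernel_coeff_def)
  also have "\<dots> = (\<Sum>i\<in>{0..N}. of_real (kernel_coeff \<beta> N (i + N)) * pochhammer w (i + N))"
    using sum.shift_bounds_cl_nat_ivl[of "\<lambda>k. of_real (kernel_coeff \<beta> N k) * pochhammer w k" 0 N N]
    by (simp add: mult_2)
  also have "\<dots> = (\<Sum>i\<le>N. pochhammer w N *
      (of_nat (N choose i) * pochhammer (w + of_nat N) i * pochhammer ?b (N - i)))"
    unfolding atMost_atLeast0
  proof (rule sum.cong)
    fix i assume "i \<in> {0..N}"
    have "of_real (kernel_coeff \<beta> N (i + N)) = of_nat (N choose i) * pochhammer ?b (N - i)"
      by (simp add: kernel_coeff_def mult_2 flip: pochhammer_of_real)
    moreover have "pochhammer w (i + N) = pochhammer w N * pochhammer (w + of_nat N) i"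
      using pochhammer_product'[of w N i] by (simp add: add.commute)
    ultimately show "of_real (kernel_coeff \<beta> N (i + N)) * pochhammer w (i + N) = pochhammer w N *
      (of_nat (N choose i) * pochhammer (w + of_nat N) i * pochhammer ?b (N - i))"
      by simp
  qed simp
  also have "\<dots> = pochhammer w N * pochhammer (w - of_real \<beta>) N"
    using pochhammer_binomial_sum[of "w + of_nat N" ?b N] by (simp add: sum_distrib_left)
  finally show ?thesis .
qed

text \<open>
  Vandermonde's identity for \<open>(u+\<beta>)\<^sub>k\<close> turns the expansion of the polynomial in the basis \<open>(u+\<beta>)\<^sub>k\<close>
  into the one in the basis \<open>(u)\<^sub>m\<close>.
\<close>

lemma sum_dual_coeff:
  fixes u :: complex
  shows "(\<Sum>m\<le>2*N. of_real (dual_coeff \<beta> N m) * pochhammer u m) =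
    pochhammer (u + of_real \<beta>) N * pochhammer u N"
proof -
  have "pochhammer (u + of_real \<beta>) k =
      (\<Sum>m\<le>2*N. of_nat (k choose m) * pochhammer u m * of_real (pochhammer \<beta> (k - m)))"
    if "k \<le> 2*N" for k
    unfolding pochhammer_binomial_sum using that
    by (intro sum.mono_neutral_cong_left) (auto simp: binomial_eq_0 pochhammer_of_real)
  then have "(\<Sum>k\<le>2*N. of_real (kernel_coeff \<beta> N k) * pochhammer (u + of_real \<beta>) k) =
      (\<Sum>k\<le>2*N. \<Sum>m\<le>2*N. of_real (kernel_coeff \<beta> N k) *
        (of_nat (k choose m) * pochhammer u m * of_real (pochhammer \<beta> (k - m))))"
    by (simp add: sum_distrib_left)
  also have "\<dots> = (\<Sum>m\<le>2*N. of_real (dual_coeff \<beta> N m) * pochhammer u m)"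
    by (subst sum.swap) (simp add: dual_coeff_def sum_distrib_left sum_distrib_right mult_ac)
  finally show ?thesis
    using sum_kernel_coeff[of \<beta> N "u + of_real \<beta>"] by simp
qed

text \<open>
  The polynomial \<open>(u+\<beta>)\<^sub>N (u)\<^sub>N\<close> vanishes at \<open>u = 0, -1, \<dots>, -(N-1)\<close>, and \<open>(-m)\<^sub>i = 0\<close> for \<open>i > m\<close>. So
  evaluation at \<open>u = -m\<close> isolates the coefficient with index \<open>m\<close> once the earlier ones are known to be \<open>0\<close>.
\<close>

lemma dual_coeff_eq_0: "m < N \<Longrightarrow> dual_coeff \<beta> N m = 0"
proof (induction m rule: less_induct)
  case (less m)
  have "(\<Sum>i\<le>2*N. of_real (dual_coeff \<beta> N i) * pochhammer (- of_nat m) i) =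
      (\<Sum>i\<in>{m}. of_real (dual_coeff \<beta> N i) * pochhammer (- of_nat m :: complex) i)"
  proof (rule sum.mono_neutral_right)
    show "\<forall>i\<in>{..2*N} - {m}. of_real (dual_coeff \<beta> N i) * pochhammer (- of_nat m :: complex) i = 0"
      using less by (metis (no_types, lifting) DiffD2 insertI1 linorder_neqE_nat mult_eq_0_iff
          of_real_0 order_less_trans pochhammer_of_nat_eq_0_lemma)
  qed (use less.prems in auto)
  moreover have "pochhammer (- of_nat m :: complex) N = 0"
    using less.prems pochhammer_of_nat_eq_0_lemma by blast
  moreover have "pochhammer (- of_nat m :: complex) m \<noteq> 0"
    by (simp add: pochhammer_same)
  ultimately show ?case
    using sum_dual_coeff[where \<beta>=\<beta> and N=N and u="- of_nat m"] by simp
qed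

section \<open>Mellin and Weyl integrals of exponential kernels\<close>

lemma Ln_of_negative_real: "x < 0 \<Longrightarrow> Ln (complex_of_real x) = of_real (ln (- x)) + \<i> * of_real pi"
  using Ln_minus[of "complex_of_real (- x)"] Ln_of_real[of "- x"] by (auto simp: Ln_of_real mult.commute)

lemma borel_measurable_of_real_powr [measurable (raw)]:
  assumes [measurable]: "f \<in> borel_measurable M"
  shows "(\<lambda>x. complex_of_real (f x) powr w) \<in> borel_measurable M"
proof -
  have "complex_of_real y powr w = (if y = 0 then 0 else if 0 < y then exp (w * of_real (ln y))
      else exp (w * (of_real (ln (- y)) + \<i> * of_real pi)))" for y
    by (auto simp: powr_def Ln_of_real Ln_of_negative_real)
  then show ?thesis
    by simp
qed

lemma gamma_integral_complex_lborel:
  fixes z :: complex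
  assumes "Re z > 0"
  shows "set_integrable lborel {0<..} (\<lambda>t. of_real t powr (z - 1) * of_real (exp (- t)))"
    and "(LINT t:{0<..}|lborel. of_real t powr (z - 1) * of_real (exp (- t))) = Gamma z"
proof -
  let ?f = "\<lambda>t. complex_of_real t powr (z - 1) * of_real (exp (- t))"
  have eq: "(\<lambda>t. of_real t powr (z - 1) / complex_of_real (exp t)) = ?f"
    by (auto simp: exp_minus field_simps)
  have "?f absolutely_integrable_on {0<..}"
    using absolutely_integrable_Gamma_integral'[OF assms] unfolding eq .
  then show int: "set_integrable lborel {0<..} ?f"
    unfolding set_integrable_def by (subst (asm) integrable_completion) auto
  then show "(LINT t:{0<..}|lborel. ?f t) = Gamma z"
    using Gamma_integral_complex'[OF assms] set_borel_integral_eq_integral(2)[OF int]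
    unfolding eq by (simp add: integral_unique)
qed

lemma gamma_integral_real_lborel:
  assumes "(a::real) > 0"
  shows "has_bochner_integral lborel (\<lambda>y. indicator {0<..} y *\<^sub>R (y powr (a - 1) * exp (- y))) (Gamma a)"
proof -
  have eq: "of_real t powr (of_real a - 1) * of_real (exp (- t)) = complex_of_real (t powr (a - 1) * exp (- t))"
    if "t > 0" for t
    using powr_of_real[of t "a - 1", symmetric] that by simp
  have "has_bochner_integral lborel
      (\<lambda>t. indicator {0<..} t *\<^sub>R (complex_of_real t powr (of_real a - 1) * of_real (exp (- t)))) (Gamma (of_real a))"
    using gamma_integral_complex_lborel[of "of_real a"] assms
    unfolding has_bochner_integral_iff set_integrable_def set_lebesgue_integral_def by simp
  from has_bochner_integral_Re[OF this]
  have "has_bochner_integral lborel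
      (\<lambda>t. Re (indicator {0<..} t *\<^sub>R (complex_of_real t powr (of_real a - 1) * of_real (exp (- t))))) (Gamma a)"
    by (simp add: Gamma_complex_of_real)
  then show ?thesis
    by (rule has_bochner_integral_cong[THEN iffD1, rotated -1])
       (auto simp only: eq indicator_simps scaleR_zero_left scaleR_one Re_complex_of_real zero_complex.sel
         split: split_indicator)
qed

text \<open>
  The substitution \<open>y = p (x - t)\<close> and the binomial expansion of \<open>(p t + y)\<^sup>k\<close> reduce the integral to
  Gamma integrals.
\<close>

lemma weyl_integral_monomial_exp:
  assumes "\<beta> > 0" "p > 0"
  shows "has_bochner_integral lborel
      (\<lambda>x. indicator {t<..} x *\<^sub>R ((x - t) powr (\<beta> - 1) * ((p * x) ^ k * exp (- (p * x)))))
      (Gamma \<beta> * p powr (- \<beta>) * (exp (- (p * t)) *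
        (\<Sum>m\<le>k. real (k choose m) * pochhammer \<beta> (k - m) * (p * t) ^ m)))"
proof -
  define c where "c = p * t"
  define v where "v = Gamma \<beta> * (exp (- c) * (\<Sum>m\<le>k. real (k choose m) * pochhammer \<beta> (k - m) * c ^ m))"
  have Gamma_shift: "Gamma (\<beta> + real j) = pochhammer \<beta> j * Gamma \<beta>" for j
    using assms by (subst pochhammer_Gamma) (auto simp: Gamma_eq_zero_iff elim!: nonpos_Ints_cases)
  have "has_bochner_integral lborel (\<lambda>y. \<Sum>m\<le>k. (exp (- c) * real (k choose m) * c ^ m) *
      (indicator {0<..} y *\<^sub>R (y powr (\<beta> + real (k - m) - 1) * exp (- y))))
      (\<Sum>m\<le>k. (exp (- c) * real (k choose m) * c ^ m) * Gamma (\<beta> + real (k - m)))"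
    using assms by (intro has_bochner_integral_sum has_bochner_integral_mult_right gamma_integral_real_lborel) auto
  also have "(\<Sum>m\<le>k. (exp (- c) * real (k choose m) * c ^ m) * Gamma (\<beta> + real (k - m))) = v"
    by (simp add: v_def Gamma_shift sum_distrib_left mult_ac del: of_nat_diff)
  finally have "has_bochner_integral lborel
      (\<lambda>y. indicator {0<..} y *\<^sub>R (y powr (\<beta> - 1) * ((c + y) ^ k * exp (- (c + y))))) v"
  proof (rule has_bochner_integral_cong[THEN iffD1, rotated -1])
    fix y :: real
    have "y powr (\<beta> + real j - 1) = y powr (\<beta> - 1) * y ^ j" if "y > 0" for j
      using that by (simp add: powr_add powr_realpow powr_diff)
    then show "(\<Sum>m\<le>k. (exp (- c) * real (k choose m) * c ^ m) *
      (indicator {0<..} y *\<^sub>R (y powr (\<beta> + real (k - m) - 1) * exp (- y)))) =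
      indicator {0<..} y *\<^sub>R (y powr (\<beta> - 1) * ((c + y) ^ k * exp (- (c + y))))"
      by (auto simp: binomial_ring[of c y k] exp_add exp_diff exp_minus divide_inverse sum_distrib_left
          sum_distrib_right mult_ac atMost_def simp del: of_nat_diff split: split_indicator)
  qed auto
  then have "has_bochner_integral lborel (\<lambda>x. p powr (1 - \<beta>) * (indicator {0<..} (- c + p * x) *\<^sub>R
      ((- c + p * x) powr (\<beta> - 1) * ((c + (- c + p * x)) ^ k * exp (- (c + (- c + p * x)))))))
      (p powr (1 - \<beta>) * (v /\<^sub>R \<bar>p\<bar>))"
    using assms by (intro has_bochner_integral_mult_right)
      (subst (asm) lborel_has_bochner_integral_real_affine_iff[of p _ _ "- c"], auto)
  also have "p powr (1 - \<beta>) * (v /\<^sub>R \<bar>p\<bar>) = p powr (- \<beta>) * v"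
    using assms by (simp add: powr_diff powr_minus field_simps)
  finally show ?thesis
  proof (rule has_bochner_integral_cong[THEN iffD1, rotated -1])
    fix x :: real
    have "(- c + p * x) powr (\<beta> - 1) = p powr (\<beta> - 1) * (x - t) powr (\<beta> - 1)" if "x > t"
      using that assms by (simp add: c_def powr_mult[symmetric] algebra_simps)
    moreover have "p powr (1 - \<beta>) * p powr (\<beta> - 1) = 1"
      using assms by (simp flip: powr_add)
    moreover have "(- c + p * x > 0) = (x > t)"
      using assms by (simp add: c_def)
    ultimately show "p powr (1 - \<beta>) * (indicator {0<..} (- c + p * x) *\<^sub>R
      ((- c + p * x) powr (\<beta> - 1) * ((c + (- c + p * x)) ^ k * exp (- (c + (- c + p * x)))))) =
      indicator {t<..} x *\<^sub>R ((x - t) powr (\<beta> - 1) * ((p * x) ^ k * exp (- (p * x))))"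
      by (auto simp: mult.assoc[symmetric] split: split_indicator)
  qed (auto simp: v_def c_def)
qed

section \<open>The Mellin transform of the Riemann-Liouville integral on the half-line\<close>

text \<open>
  Fractional integration by parts, for a nonnegative \<open>\<phi>\<close> with the Weyl integral \<open>\<psi>\<close>. Nonnegativity
  makes \<open>\<bar>f\<bar> \<psi>\<close> the integral of the absolute value of the double integrand, so Fubini's theorem
  applies as soon as \<open>f \<psi>\<close> is integrable.
\<close>

lemma integral_riemann_liouville_mult:
  fixes f :: "real \<Rightarrow> complex" and \<phi> \<psi> :: "real \<Rightarrow> real"
  assumes [measurable]: "f \<in> borel_measurable borel" "\<phi> \<in> borel_measurable borel"
    and nonneg: "\<And>x. x > 0 \<Longrightarrow> \<phi> x \<ge> 0"
    and weyl: "\<And>t. t > 0 \<Longrightarrow> has_bochner_integral lborel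
      (\<lambda>x. indicator {t<..} x *\<^sub>R ((x - t) powr (\<beta> - 1) * \<phi> x)) (\<psi> t)"
    and int: "set_integrable lborel {0<..} (\<lambda>t. f t * of_real (\<psi> t))"
  shows "set_integrable lborel {0<..} (\<lambda>x.
      (LINT t:{0<..<x}|lborel. f t * of_real ((x - t) powr (\<beta> - 1))) * of_real (\<phi> x))"
    and "(LINT x:{0<..}|lborel.
      (LINT t:{0<..<x}|lborel. f t * of_real ((x - t) powr (\<beta> - 1))) * of_real (\<phi> x)) =
      (LINT t:{0<..}|lborel. f t * of_real (\<psi> t))"
proof -
  define K where "K t x = (if 0 < t \<and> t < x then f t * of_real ((x - t) powr (\<beta> - 1) * \<phi> x) else 0)" for t x
  have K_meas [measurable]: "case_prod K \<in> borel_measurable (lborel \<Otimes>\<^sub>M lborel)"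
    unfolding K_def by measurable
  have K_x: "has_bochner_integral lborel (K t) (indicator {0<..} t *\<^sub>R (f t * of_real (\<psi> t)))" for t
  proof (cases "t > 0")
    case True
    have "has_bochner_integral lborel (\<lambda>x. f t * complex_of_real (indicator {t<..} x *\<^sub>R ((x - t) powr (\<beta> - 1) * \<phi> x)))
        (f t * of_real (\<psi> t))"
      by (intro has_bochner_integral_mult_right has_bochner_integral_of_real weyl True)
    then show ?thesis
      by (rule has_bochner_integral_cong[THEN iffD1, rotated -1])
        (use True in \<open>auto simp: K_def split: split_indicator\<close>)
  qed (auto simp: K_def[abs_def])
  have K_norm: "has_bochner_integral lborel (\<lambda>x. norm (K t x)) (norm (indicator {0<..} t *\<^sub>R (f t * of_real (\<psi> t))))" for t
  proof (cases "t > 0")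
    case True
    have "has_bochner_integral lborel (\<lambda>x. norm (f t) * (indicator {t<..} x *\<^sub>R ((x - t) powr (\<beta> - 1) * \<phi> x)))
        (norm (f t) * \<psi> t)"
      by (intro has_bochner_integral_mult_right weyl True)
    moreover have "\<psi> t \<ge> 0"
    proof -
      have "\<psi> t = (LINT x|lborel. indicator {t<..} x *\<^sub>R ((x - t) powr (\<beta> - 1) * \<phi> x))"
        using weyl[OF True] by (simp add: has_bochner_integral_iff)
      also have "\<dots> \<ge> 0"
        using True nonneg by (intro integral_nonneg_AE) (auto split: split_indicator)
      finally show ?thesis .
    qed
    ultimately have "has_bochner_integral lborel (\<lambda>x. norm (f t) * (indicator {t<..} x *\<^sub>R ((x - t) powr (\<beta> - 1) * \<phi> x)))
        (norm (indicator {0<..} t *\<^sub>R (f t * of_real (\<psi> t))))"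
      using True by (simp add: norm_mult)
    then show ?thesis
      by (rule has_bochner_integral_cong[THEN iffD1, rotated -1])
        (use True nonneg in \<open>auto simp: K_def norm_mult split: split_indicator\<close>)
  qed (auto simp: K_def[abs_def])
  have K_int: "integrable (lborel \<Otimes>\<^sub>M lborel) (case_prod K)"
  proof (rule lborel_pair.Fubini_integrable)
    show "integrable lborel (\<lambda>t. LINT x|lborel. norm (case_prod K (t, x)))"
      using int[unfolded set_integrable_def, THEN integrable_norm] K_norm
      by (simp add: has_bochner_integral_iff)
    show "AE t in lborel. integrable lborel (\<lambda>x. case_prod K (t, x))"
      using K_x by (simp add: has_bochner_integral_iff)
  qed measurable
  have K_t: "(LINT t|lborel. K t x) = indicator {0<..} x *\<^sub>R
      ((LINT t:{0<..<x}|lborel. f t * of_real ((x - t) powr (\<beta> - 1))) * of_real (\<phi> x))" for x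
  proof -
    have "(LINT t|lborel. K t x) = (LINT t:{0<..<x}|lborel. f t * of_real ((x - t) powr (\<beta> - 1)) * of_real (\<phi> x))"
      unfolding set_lebesgue_integral_def
      by (rule Bochner_Integration.integral_cong) (auto simp: K_def split: split_indicator)
    then show ?thesis
      by (auto simp: set_lebesgue_integral_def split: split_indicator)
  qed
  show "set_integrable lborel {0<..} (\<lambda>x.
      (LINT t:{0<..<x}|lborel. f t * of_real ((x - t) powr (\<beta> - 1))) * of_real (\<phi> x))"
    using lborel_pair.integrable_snd[OF K_int] by (simp add: K_t set_integrable_def)
  show "(LINT x:{0<..}|lborel.
      (LINT t:{0<..<x}|lborel. f t * of_real ((x - t) powr (\<beta> - 1))) * of_real (\<phi> x)) =
      (LINT t:{0<..}|lborel. f t * of_real (\<psi> t))"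
    using lborel_pair.Fubini_integral[OF K_int] K_x
    by (simp add: K_t set_lebesgue_integral_def has_bochner_integral_iff)
qed

text \<open>
  For fixed \<open>x\<close> the substitution \<open>q = p x\<close> pulls out the factor \<open>x\<^bsup>z-1\<^esup>\<close>; the same computation with
  absolute values justifies the exchange of the integrals.
\<close>

lemma mellin_multiplicative_convolution:
  fixes h :: "real \<Rightarrow> complex" and \<phi> :: "real \<Rightarrow> real"
  assumes [measurable]: "h \<in> borel_measurable borel" "\<phi> \<in> borel_measurable borel"
    and h: "set_integrable lborel {0<..} (\<lambda>x. h x * of_real x powr (z - 1))"
    and \<phi>: "set_integrable lborel {0<..} (\<lambda>q. of_real q powr (- z) * of_real (\<phi> q))"
  shows "(LINT p:{0<..}|lborel. of_real p powr (- z) * (LINT x:{0<..}|lborel. h x * of_real (\<phi> (p * x)))) =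
    (LINT x:{0<..}|lborel. h x * of_real x powr (z - 1)) *
    (LINT q:{0<..}|lborel. of_real q powr (- z) * of_real (\<phi> q))"
proof -
  define G where "G q = indicator {0<..} q *\<^sub>R (complex_of_real q powr (- z) * of_real (\<phi> q))" for q
  define K where "K x p = (if 0 < x \<and> 0 < p then h x * (of_real p powr (- z) * of_real (\<phi> (p * x))) else 0)" for x p
  define H where "H x = indicator {0<..} x *\<^sub>R (h x * of_real x powr (z - 1))" for x
  have G_int: "integrable lborel G" and H_int: "integrable lborel H"
    using \<phi> h unfolding G_def H_def set_integrable_def .
  have K_meas [measurable]: "case_prod K \<in> borel_measurable (lborel \<Otimes>\<^sub>M lborel)"
    unfolding K_def by measurable
  have K_eq: "K x p = h x * of_real x powr z * G (0 + x * p)" if "x > 0" for x p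
  proof (cases "p > 0")
    case True
    then have "complex_of_real (x * p) powr (- z) = of_real x powr (- z) * of_real p powr (- z)"
      using that powr_times_real[of "of_real x" "of_real p" "- z"] by simp
    moreover have "complex_of_real x powr z * of_real x powr (- z) = 1"
      using that by (simp add: powr_minus)
    ultimately show ?thesis
      using True that by (simp add: K_def G_def mult_ac)
  next
    case False
    then have "\<not> x * p > 0"
      using that by (simp add: zero_less_mult_iff)
    then show ?thesis
      using False by (simp add: K_def G_def)
  qed
  have pow: "h x * of_real x powr z * (c / complex_of_real x) = H x * c" if "x > 0" for x c
    using that by (simp add: H_def powr_diff)
  have K_p: "has_bochner_integral lborel (K x) (H x * (LINT q|lborel. G q))" for x
  proof (cases "x > 0")
    case True
    have "has_bochner_integral lborel (\<lambda>p. G (0 + x * p)) ((LINT q|lborel. G q) /\<^sub>R \<bar>x\<bar>)"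
      using True G_int by (subst lborel_has_bochner_integral_real_affine_iff[symmetric])
        (auto intro: has_bochner_integral_integrable)
    moreover have "(LINT q|lborel. G q) /\<^sub>R \<bar>x\<bar> = (LINT q|lborel. G q) / of_real x"
      using True by (simp add: scaleR_conv_of_real divide_inverse mult.commute)
    ultimately have "has_bochner_integral lborel (\<lambda>p. h x * of_real x powr z * G (0 + x * p))
        (H x * (LINT q|lborel. G q))"
      unfolding pow[OF True, symmetric] by (intro has_bochner_integral_mult_right) simp
    then show ?thesis
      by (simp only: K_eq[OF True, abs_def])
  qed (auto simp: K_def[abs_def] H_def)
  have K_norm: "has_bochner_integral lborel (\<lambda>p. norm (K x p)) (norm (H x) * (LINT q|lborel. norm (G q)))" for x
  proof (cases "x > 0")
    case True
    have "has_bochner_integral lborel (\<lambda>p. norm (G (0 + x * p))) ((LINT q|lborel. norm (G q)) /\<^sub>R \<bar>x\<bar>)"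
      using True G_int by (subst lborel_has_bochner_integral_real_affine_iff[symmetric, where f = "\<lambda>q. norm (G q)"])
        (auto intro: has_bochner_integral_integrable)
    from has_bochner_integral_mult_right[OF this, of "norm (h x * of_real x powr z)"]
    have "has_bochner_integral lborel (\<lambda>p. norm (K x p))
        (norm (h x * of_real x powr z) * ((LINT q|lborel. norm (G q)) /\<^sub>R \<bar>x\<bar>))"
      by (simp only: K_eq[OF True] norm_mult)
    moreover have "norm (H x) = norm (h x * of_real x powr z) / x"
      using True arg_cong[OF pow[OF True, of 1], of norm] by (simp add: norm_mult norm_divide)
    ultimately show ?thesis
      using True by (simp add: divide_inverse mult_ac)
  qed (auto simp: K_def[abs_def] H_def)
  have K_int: "integrable (lborel \<Otimes>\<^sub>M lborel) (case_prod K)"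
  proof (rule lborel_pair.Fubini_integrable)
    show "integrable lborel (\<lambda>x. LINT p|lborel. norm (case_prod K (x, p)))"
      using H_int[THEN integrable_norm] K_norm by (simp add: has_bochner_integral_iff)
    show "AE x in lborel. integrable lborel (\<lambda>p. case_prod K (x, p))"
      using K_p by (simp add: has_bochner_integral_iff)
  qed measurable
  have K_x: "(LINT x|lborel. K x p) = indicator {0<..} p *\<^sub>R
      (of_real p powr (- z) * (LINT x:{0<..}|lborel. h x * of_real (\<phi> (p * x))))" for p
  proof -
    have "(LINT x|lborel. K x p) = (LINT x:{0<..}|lborel.
        (indicator {0<..} p *\<^sub>R of_real p powr (- z)) * (h x * of_real (\<phi> (p * x))))"
      unfolding set_lebesgue_integral_def
      by (rule Bochner_Integration.integral_cong) (auto simp: K_def split: split_indicator)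
    then show ?thesis
      by simp
  qed
  show ?thesis
    using lborel_pair.Fubini_integral[OF K_int] K_p
    by (simp add: K_x set_lebesgue_integral_def has_bochner_integral_iff flip: G_def H_def)
qed

text \<open>
  The functions \<open>\<phi>\<close> and \<open>\<psi>\<close> of the introduction are \<open>exp_kernel (kernel_coeff \<beta> N) (2*N)\<close> and
  \<open>exp_kernel (dual_coeff \<beta> N) (2*N)\<close>.
\<close>

definition exp_kernel :: "(nat \<Rightarrow> real) \<Rightarrow> nat \<Rightarrow> real \<Rightarrow> real" where
  "exp_kernel c n y = (\<Sum>k\<le>n. c k * (y ^ k * exp (- y)))"

lemma borel_measurable_exp_kernel [measurable]: "exp_kernel c n \<in> borel_measurable borel"
  unfolding exp_kernel_def by measurable

lemma power_times_exp_minus_le_fact: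
  assumes "y \<ge> (0::real)"
  shows "y ^ m * exp (- y) \<le> fact m"
proof -
  obtain t where "exp y = (\<Sum>i<Suc m. y ^ i / fact i) + exp t / fact (Suc m) * y ^ Suc m"
    using Maclaurin_exp_le[of y "Suc m"] by blast
  moreover have "(\<Sum>i<Suc m. y ^ i / fact i) \<ge> y ^ m / fact m"
    using assms by (simp add: sum_nonneg)
  moreover have "exp t / fact (Suc m) * y ^ Suc m \<ge> 0"
    using assms by simp
  ultimately have "y ^ m / fact m \<le> exp y"
    by linarith
  then show ?thesis
    by (simp add: exp_minus field_simps)
qed

text \<open>
  Absolute convergence at \<open>0\<close> needs only \<open>Re w + N > 0\<close>, because the powers below \<open>N\<close> are missing; the
  right-hand side continues the Gamma integral to these \<open>w\<close>.
\<close>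

lemma mellin_exp_kernel:
  fixes w :: complex
  assumes c: "\<And>k. k < N \<Longrightarrow> c k = 0" and w: "Re w + real N > 0" "w \<notin> \<int>\<^sub>\<le>\<^sub>0"
  shows "set_integrable lborel {0<..} (\<lambda>q. of_real q powr (w - 1) * of_real (exp_kernel c n q))"
    and "(LINT q:{0<..}|lborel. of_real q powr (w - 1) * of_real (exp_kernel c n q)) =
      Gamma w * (\<Sum>k\<le>n. of_real (c k) * pochhammer w k)"
proof -
  have "has_bochner_integral lborel (\<lambda>q. of_real (c k) * (indicator {0<..} q *\<^sub>R
      (complex_of_real q powr (w + of_nat k - 1) * of_real (exp (- q))))) (of_real (c k) * (Gamma w * pochhammer w k))"
    for k
  proof (cases "k < N")
    case False
    have "Gamma (w + of_nat k) = Gamma w * pochhammer w k"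
      using w(2) by (simp add: pochhammer_Gamma Gamma_eq_zero_iff)
    then show ?thesis
      using gamma_integral_complex_lborel[of "w + of_nat k"] w(1) False
      by (intro has_bochner_integral_mult_right)
        (auto simp: has_bochner_integral_iff set_integrable_def set_lebesgue_integral_def)
  qed (auto simp: c)
  then have "has_bochner_integral lborel (\<lambda>q. \<Sum>k\<le>n. of_real (c k) * (indicator {0<..} q *\<^sub>R
      (complex_of_real q powr (w + of_nat k - 1) * of_real (exp (- q)))))
      (\<Sum>k\<le>n. of_real (c k) * (Gamma w * pochhammer w k))"
    by (intro has_bochner_integral_sum)
  also have "(\<Sum>k\<le>n. of_real (c k) * (Gamma w * pochhammer w k)) = Gamma w * (\<Sum>k\<le>n. of_real (c k) * pochhammer w k)"
    by (simp add: sum_distrib_left mult_ac)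
  finally have "has_bochner_integral lborel
      (\<lambda>q. indicator {0<..} q *\<^sub>R (of_real q powr (w - 1) * of_real (exp_kernel c n q)))
      (Gamma w * (\<Sum>k\<le>n. of_real (c k) * pochhammer w k))"
  proof (rule has_bochner_integral_cong[THEN iffD1, rotated -1])
    fix q :: real
    have "complex_of_real q powr (w + of_nat k - 1) = of_real q powr (w - 1) * of_real q ^ k" if "q > 0" for k
      using that powr_add[of "complex_of_real q" "w - 1" "of_nat k"]
      by (simp add: algebra_simps powr_nat)
    then show "(\<Sum>k\<le>n. of_real (c k) * (indicator {0<..} q *\<^sub>R
      (complex_of_real q powr (w + of_nat k - 1) * of_real (exp (- q))))) =
      indicator {0<..} q *\<^sub>R (of_real q powr (w - 1) * of_real (exp_kernel c n q))"
      by (auto simp: exp_kernel_def sum_distrib_left mult_ac atMost_def split: split_indicator)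
  qed auto
  then show "set_integrable lborel {0<..} (\<lambda>q. of_real q powr (w - 1) * of_real (exp_kernel c n q))"
    and "(LINT q:{0<..}|lborel. of_real q powr (w - 1) * of_real (exp_kernel c n q)) =
      Gamma w * (\<Sum>k\<le>n. of_real (c k) * pochhammer w k)"
    by (simp_all add: has_bochner_integral_iff set_integrable_def set_lebesgue_integral_def)
qed

text \<open>
  Near \<open>0\<close> the factor is bounded, so integrability of \<open>f\<close> is used. Away from \<open>0\<close> it decays faster
  than any power, so it is dominated by the factor in the Mellin integral, whatever \<open>w\<close> is.
\<close>

lemma set_integrable_mult_power_exp:
  fixes f :: "real \<Rightarrow> complex"
  assumes [measurable]: "f \<in> borel_measurable borel"
    and y: "y > 0" "set_integrable lborel {0<..<y} f"
    and mellin: "set_integrable lborel {0<..} (\<lambda>x. f x * of_real x powr (w - 1))"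
    and p: "p > 0"
  shows "set_integrable lborel {0<..} (\<lambda>x. f x * of_real ((p * x) ^ m * exp (- (p * x))))"
proof -
  let ?g = "\<lambda>x. f x * complex_of_real ((p * x) ^ m * exp (- (p * x)))"
  have "set_integrable lborel {0<..<y} ?g"
  proof (rule set_integrable_bound)
    show "set_integrable lborel {0<..<y} (\<lambda>x. of_real (fact m) * f x)"
      using y(2) by simp
    show "AE x in lborel. x \<in> {0<..<y} \<longrightarrow> norm (?g x) \<le> norm (of_real (fact m) * f x)"
    proof (intro AE_I2 impI)
      fix x assume "x \<in> {0<..<y}"
      with p have "norm (f x) * \<bar>(p * x) ^ m * exp (- (p * x))\<bar> \<le> norm (f x) * fact m"
        by (intro mult_left_mono) (auto intro!: power_times_exp_minus_le_fact)
      then show "norm (?g x) \<le> norm (of_real (fact m) * f x)"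
        unfolding norm_mult norm_of_real by (simp add: mult.commute)
    qed
  qed (simp add: set_borel_measurable_def)
  moreover have "set_integrable lborel {y..} ?g"
  proof -
    \<comment> \<open>With \<open>n \<ge> 1 - Re w\<close> further powers, \<open>x\<^bsup>-n\<^esup>\<close> is at most a constant times \<open>x\<^bsup>Re w-1\<^esup>\<close> for \<open>x \<ge> y\<close>.\<close>
    define n where "n = nat \<lceil>1 - Re w\<rceil>"
    define C where "C = fact (m + n) / p ^ n * y powr (1 - Re w - real n)"
    have n: "1 - Re w - real n \<le> 0"
      unfolding n_def by linarith
    show ?thesis
    proof (rule set_integrable_bound)
      show "set_integrable lborel {y..} (\<lambda>x. of_real C * (f x * of_real x powr (w - 1)))"
        using y(1) by (intro set_integrable_mult_right set_integrable_subset[OF mellin]) auto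
      show "AE x in lborel. x \<in> {y..} \<longrightarrow> norm (?g x) \<le> norm (of_real C * (f x * of_real x powr (w - 1)))"
      proof (intro AE_I2 impI)
        fix x assume "x \<in> {y..}"
        then have x: "x \<ge> y" "x > 0"
          using y(1) by auto
        have "(p * x) ^ m * exp (- (p * x)) = (p * x) ^ (m + n) * exp (- (p * x)) / (p * x) ^ n"
          using x p by (simp add: power_add)
        also have "\<dots> \<le> fact (m + n) / (p * x) ^ n"
          using x p by (intro divide_right_mono power_times_exp_minus_le_fact) auto
        also have "\<dots> = fact (m + n) / p ^ n * (x powr (Re w - 1) * x powr (1 - Re w - real n))"
          using x by (simp add: power_mult_distrib powr_minus powr_realpow divide_simps flip: powr_add)
        also have "\<dots> \<le> fact (m + n) / p ^ n * (x powr (Re w - 1) * y powr (1 - Re w - real n))"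
          using x y(1) p n by (intro mult_left_mono powr_mono2') auto
        finally have "(p * x) ^ m * exp (- (p * x)) \<le> C * x powr (Re w - 1)"
          by (simp add: C_def mult_ac)
        then have "norm (f x) * \<bar>(p * x) ^ m * exp (- (p * x))\<bar> \<le> norm (f x) * (C * x powr (Re w - 1))"
          using x p by (intro mult_left_mono) auto
        moreover have "C \<ge> 0"
          using p by (simp add: C_def)
        ultimately show "norm (?g x) \<le> norm (of_real C * (f x * of_real x powr (w - 1)))"
          using x unfolding norm_mult norm_of_real by (simp add: norm_powr_real_powr mult_ac)
      qed
    qed (simp add: set_borel_measurable_def)
  qed
  moreover have "{0<..} = {0<..<y} \<union> {y..}"
    using y(1) by auto
  ultimately show ?thesis
    by (metis set_integrable_Un sets_lborel borel_open borel_closed closed_atLeast open_greaterThanLessThan)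
qed

text \<open>
  Fractional integration by parts is applied to each monomial \<open>(p x)\<^sup>k\<close> of the kernel, whose
  contribution is nonnegative, and the results are summed; reordering the double sum produces
  \<open>dual_coeff\<close>.
\<close>

lemma integral_riemann_liouville_mult_exp_kernel:
  fixes f g :: "real \<Rightarrow> complex"
  assumes [measurable]: "f \<in> borel_measurable borel" "g \<in> borel_measurable borel"
    and \<beta>: "\<beta> > 0" and p: "p > 0"
    and rl: "\<And>x. x > 0 \<Longrightarrow>
      g x = (LINT t:{0<..<x}|lborel. f t * of_real ((x - t) powr (\<beta> - 1))) / of_real (Gamma \<beta>)"
    and int: "\<And>m. set_integrable lborel {0<..} (\<lambda>x. f x * of_real ((p * x) ^ m * exp (- (p * x))))"
  shows "(LINT x:{0<..}|lborel. g x * of_real (exp_kernel (kernel_coeff \<beta> N) (2*N) (p * x))) =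
    of_real p powr (- of_real \<beta>) *
      (LINT x:{0<..}|lborel. f x * of_real (exp_kernel (dual_coeff \<beta> N) (2*N) (p * x)))"
proof -
  let ?P = "complex_of_real p powr (- of_real \<beta>)"
  define F where "F m = (LINT x:{0<..}|lborel. f x * of_real ((p * x) ^ m * exp (- (p * x))))" for m
  define G where "G k = (LINT x:{0<..}|lborel. g x * of_real ((p * x) ^ k * exp (- (p * x))))" for k
  have Gamma_pos: "Gamma \<beta> > 0"
    using \<beta> by (rule Gamma_real_pos)
  have P: "?P = of_real (p powr (- \<beta>))"
    using p powr_of_real[of p "- \<beta>"] by simp
  have sum_has_integral: "has_bochner_integral lborel
      (\<lambda>x. indicator {0<..} x *\<^sub>R (h x * of_real (\<Sum>i\<le>n. c i * ((p * x) ^ i * exp (- (p * x))))))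
      (\<Sum>i\<le>n. of_real (c i) * (LINT x:{0<..}|lborel. h x * of_real ((p * x) ^ i * exp (- (p * x)))))"
    if "\<And>i. set_integrable lborel {0<..} (\<lambda>x. h x * of_real ((p * x) ^ i * exp (- (p * x))))"
    for h :: "real \<Rightarrow> complex" and c n
  proof -
    have "has_bochner_integral lborel (\<lambda>x. \<Sum>i\<le>n. of_real (c i) *
      (indicator {0<..} x *\<^sub>R (h x * of_real ((p * x) ^ i * exp (- (p * x))))))
      (\<Sum>i\<le>n. of_real (c i) * (LINT x:{0<..}|lborel. h x * of_real ((p * x) ^ i * exp (- (p * x)))))"
      using that unfolding set_integrable_def set_lebesgue_integral_def
      by (intro has_bochner_integral_sum has_bochner_integral_mult_right has_bochner_integral_integrable)
    then show ?thesis
      by (rule has_bochner_integral_cong[THEN iffD1, rotated -1])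
        (auto simp: sum_distrib_left mult_ac atMost_def split: split_indicator)
  qed
  have G: "set_integrable lborel {0<..} (\<lambda>x. g x * of_real ((p * x) ^ k * exp (- (p * x)))) \<and>
      G k = ?P * (\<Sum>m\<le>k. of_real (real (k choose m) * pochhammer \<beta> (k - m)) * F m)" for k
  proof -
    define \<psi> where "\<psi> t = Gamma \<beta> * p powr (- \<beta>) * (exp (- (p * t)) *
        (\<Sum>m\<le>k. real (k choose m) * pochhammer \<beta> (k - m) * (p * t) ^ m))" for t
    have \<psi>_eq: "indicator {0<..} t *\<^sub>R (f t * of_real (\<psi> t)) = of_real (Gamma \<beta> * p powr (- \<beta>)) *
       (indicator {0<..} t *\<^sub>R (f t * of_real (\<Sum>m\<le>k. (real (k choose m) * pochhammer \<beta> (k - m)) * ((p * t) ^ m * exp (- (p * t))))))" for t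
      by (simp add: \<psi>_def sum_distrib_left mult_ac)
    have \<psi>_sum: "has_bochner_integral lborel (\<lambda>t. indicator {0<..} t *\<^sub>R (f t * of_real (\<psi> t)))
        (of_real (Gamma \<beta> * p powr (- \<beta>)) * (\<Sum>m\<le>k. of_real (real (k choose m) * pochhammer \<beta> (k - m)) * F m))"
      unfolding \<psi>_eq F_def
      by (intro has_bochner_integral_mult_right sum_has_integral int)
    have g_eq: "g x = (1 / of_real (Gamma \<beta>)) * (LINT t:{0<..<x}|lborel. f t * of_real ((x - t) powr (\<beta> - 1)))"
      if "x > 0" for x
      using rl[OF that] by simp
    have "set_integrable lborel {0<..} (\<lambda>t. f t * of_real (\<psi> t))"
      using \<psi>_sum unfolding set_integrable_def has_bochner_integral_iff by blast
    moreover have "has_bochner_integral lborel (\<lambda>x. indicator {t<..} x *\<^sub>R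
        ((x - t) powr (\<beta> - 1) * ((p * x) ^ k * exp (- (p * x))))) (\<psi> t)" for t
      unfolding \<psi>_def by (rule weyl_integral_monomial_exp[OF \<beta> p])
    moreover have "(\<lambda>x. (p * x) ^ k * exp (- (p * x))) \<in> borel_measurable borel"
      by measurable
    moreover have "(p * x) ^ k * exp (- (p * x)) \<ge> 0" if "x > 0" for x
      using that p by simp
    ultimately have *: "set_integrable lborel {0<..} (\<lambda>x.
        (LINT t:{0<..<x}|lborel. f t * of_real ((x - t) powr (\<beta> - 1))) * of_real ((p * x) ^ k * exp (- (p * x))))"
      "(LINT x:{0<..}|lborel.
        (LINT t:{0<..<x}|lborel. f t * of_real ((x - t) powr (\<beta> - 1))) * of_real ((p * x) ^ k * exp (- (p * x)))) =
        (LINT t:{0<..}|lborel. f t * of_real (\<psi> t))"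
      by (intro integral_riemann_liouville_mult; simp)+
    have "set_integrable lborel {0<..} (\<lambda>x. g x * of_real ((p * x) ^ k * exp (- (p * x)))) \<longleftrightarrow>
        set_integrable lborel {0<..} (\<lambda>x. 1 / of_real (Gamma \<beta>) *
          ((LINT t:{0<..<x}|lborel. f t * of_real ((x - t) powr (\<beta> - 1))) * of_real ((p * x) ^ k * exp (- (p * x)))))"
      by (rule set_integrable_cong) (auto simp: g_eq)
    moreover have "G k = (LINT x:{0<..}|lborel. 1 / of_real (Gamma \<beta>) *
          ((LINT t:{0<..<x}|lborel. f t * of_real ((x - t) powr (\<beta> - 1))) * of_real ((p * x) ^ k * exp (- (p * x)))))"
      unfolding G_def by (rule set_lebesgue_integral_cong) (auto simp: g_eq)
    moreover have "\<dots> = 1 / of_real (Gamma \<beta>) * (LINT t:{0<..}|lborel. f t * of_real (\<psi> t))"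
      by (subst set_integral_mult_right) (simp only: *(2))
    ultimately show ?thesis
      using *(1) \<psi>_sum Gamma_pos
      by (simp add: P has_bochner_integral_iff set_lebesgue_integral_def)
  qed
  have "(LINT x:{0<..}|lborel. g x * of_real (exp_kernel (kernel_coeff \<beta> N) (2*N) (p * x))) =
      (\<Sum>k\<le>2*N. of_real (kernel_coeff \<beta> N k) * G k)"
    using sum_has_integral[of g "kernel_coeff \<beta> N" "2*N"] G
    by (simp add: exp_kernel_def has_bochner_integral_iff set_lebesgue_integral_def G_def)
  also have "\<dots> = (\<Sum>k\<le>2*N. of_real (kernel_coeff \<beta> N k) *
      (?P * (\<Sum>m\<le>2*N. of_real (real (k choose m) * pochhammer \<beta> (k - m)) * F m)))"
  proof (rule sum.cong)
    fix k assume "k \<in> {..2*N}"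
    then have "(\<Sum>m\<le>k. complex_of_real (real (k choose m) * pochhammer \<beta> (k - m)) * F m) =
        (\<Sum>m\<le>2*N. of_real (real (k choose m) * pochhammer \<beta> (k - m)) * F m)"
      by (intro sum.mono_neutral_left) (auto simp: binomial_eq_0)
    then show "of_real (kernel_coeff \<beta> N k) * G k = of_real (kernel_coeff \<beta> N k) *
      (?P * (\<Sum>m\<le>2*N. of_real (real (k choose m) * pochhammer \<beta> (k - m)) * F m))"
      using G by simp
  qed simp
  also have "\<dots> = ?P * (\<Sum>k\<le>2*N. \<Sum>m\<le>2*N. of_real (kernel_coeff \<beta> N k) *
      (of_real (real (k choose m) * pochhammer \<beta> (k - m)) * F m))"
    by (simp add: sum_distrib_left mult_ac)
  also have "\<dots> = ?P * (\<Sum>m\<le>2*N. of_real (dual_coeff \<beta> N m) * F m)"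
    by (subst sum.swap) (simp add: dual_coeff_def sum_distrib_left sum_distrib_right mult_ac)
  also have "(\<Sum>m\<le>2*N. of_real (dual_coeff \<beta> N m) * F m) =
      (LINT x:{0<..}|lborel. f x * of_real (exp_kernel (dual_coeff \<beta> N) (2*N) (p * x)))"
    using sum_has_integral[of f "dual_coeff \<beta> N" "2*N"] int
    by (simp add: exp_kernel_def has_bochner_integral_iff set_lebesgue_integral_def F_def)
  finally show ?thesis .
qed

text \<open>
  \<open>N\<close> is chosen beyond \<open>Re s + \<beta>\<close>, so that both kernels have absolutely convergent Mellin integrals
  at the exponents in question.
\<close>

theorem mellin_riemann_liouville:
  fixes f g :: "real \<Rightarrow> complex" and s :: complex
  assumes [measurable]: "f \<in> borel_measurable borel" "g \<in> borel_measurable borel"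
    and \<beta>: "\<beta> > 0"
    and near_0: "y > 0" "set_integrable lborel {0<..<y} f"
    and rl: "\<And>x. x > 0 \<Longrightarrow>
      g x = (LINT t:{0<..<x}|lborel. f t * of_real ((x - t) powr (\<beta> - 1))) / of_real (Gamma \<beta>)"
    and mellin_g: "set_integrable lborel {0<..} (\<lambda>x. g x * of_real x powr (s - 1))"
    and mellin_f: "set_integrable lborel {0<..} (\<lambda>x. f x * of_real x powr (s + of_real \<beta> - 1))"
    and poles: "1 - s - of_real \<beta> \<notin> \<int>\<^sub>\<le>\<^sub>0" "1 - s \<notin> \<int>\<^sub>\<le>\<^sub>0"
  shows "(LINT x:{0<..}|lborel. g x * of_real x powr (s - 1)) =
    Gamma (1 - s - of_real \<beta>) / Gamma (1 - s) *
      (LINT x:{0<..}|lborel. f x * of_real x powr (s + of_real \<beta> - 1))"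
proof -
  obtain N :: nat where N: "Re s + \<beta> < real N"
    using reals_Archimedean2 by blast
  let ?\<phi> = "exp_kernel (kernel_coeff \<beta> N) (2*N)" and ?\<psi> = "exp_kernel (dual_coeff \<beta> N) (2*N)"
  define w u where "w = 1 - s" and "u = 1 - s - of_real \<beta>"
  let ?A = "pochhammer w N * pochhammer u N"
  have \<phi>: "set_integrable lborel {0<..} (\<lambda>q. of_real q powr (- s) * of_real (?\<phi> q))"
    "(LINT q:{0<..}|lborel. of_real q powr (- s) * of_real (?\<phi> q)) = Gamma w * ?A"
    using mellin_exp_kernel[of N "kernel_coeff \<beta> N" w "2*N"] N \<beta> poles sum_kernel_coeff[of \<beta> N w]
    by (auto simp: kernel_coeff_def w_def u_def)
  have \<psi>: "set_integrable lborel {0<..} (\<lambda>q. of_real q powr (- (s + of_real \<beta>)) * of_real (?\<psi> q))"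
    "(LINT q:{0<..}|lborel. of_real q powr (- (s + of_real \<beta>)) * of_real (?\<psi> q)) = Gamma u * ?A"
    using mellin_exp_kernel[of N "dual_coeff \<beta> N" u "2*N"] N \<beta> poles sum_dual_coeff[of \<beta> N u]
    by (auto simp: dual_coeff_eq_0 w_def u_def algebra_simps)
  have "(LINT x:{0<..}|lborel. g x * of_real x powr (s - 1)) * (Gamma w * ?A) =
      (LINT p:{0<..}|lborel. of_real p powr (- s) * (LINT x:{0<..}|lborel. g x * of_real (?\<phi> (p * x))))"
    using mellin_multiplicative_convolution[OF _ _ mellin_g \<phi>(1)] \<phi>(2) by simp
  also have "\<dots> = (LINT p:{0<..}|lborel. of_real p powr (- (s + of_real \<beta>)) *
      (LINT x:{0<..}|lborel. f x * of_real (?\<psi> (p * x))))"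
  proof (rule set_lebesgue_integral_cong)
    show "\<forall>p. p \<in> {0<..} \<longrightarrow> of_real p powr (- s) * (LINT x:{0<..}|lborel. g x * of_real (?\<phi> (p * x))) =
      of_real p powr (- (s + of_real \<beta>)) * (LINT x:{0<..}|lborel. f x * of_real (?\<psi> (p * x)))"
    proof (intro allI impI)
      fix p :: real assume "p \<in> {0<..}"
      then have p: "p > 0" by simp
      have "complex_of_real p powr (- (s + of_real \<beta>)) = of_real p powr (- s) * of_real p powr (- of_real \<beta>)"
        by (simp flip: powr_add)
      then show "of_real p powr (- s) * (LINT x:{0<..}|lborel. g x * of_real (?\<phi> (p * x))) =
        of_real p powr (- (s + of_real \<beta>)) * (LINT x:{0<..}|lborel. f x * of_real (?\<psi> (p * x)))"
        using integral_riemann_liouville_mult_exp_kernel[OF _ _ \<beta> p rl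
            set_integrable_mult_power_exp[OF _ near_0 mellin_f p], of N]
        by simp
    qed
  qed simp
  also have "\<dots> = (LINT x:{0<..}|lborel. f x * of_real x powr (s + of_real \<beta> - 1)) * (Gamma u * ?A)"
    using mellin_multiplicative_convolution[OF _ _ mellin_f \<psi>(1)] \<psi>(2) by simp
  finally have "(LINT x:{0<..}|lborel. g x * of_real x powr (s - 1)) * Gamma w * ?A =
      (LINT x:{0<..}|lborel. f x * of_real x powr (s + of_real \<beta> - 1)) * Gamma u * ?A"
    by (simp add: mult_ac)
  moreover have "?A \<noteq> 0"
    using poles by (auto simp: w_def u_def pochhammer_eq_0_iff)
  moreover have "Gamma w \<noteq> 0"
    using poles by (simp add: w_def Gamma_eq_zero_iff)
  ultimately show ?thesis
    by (simp add: w_def u_def field_simps)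
qed

section \<open>Transfer to the curve\<close>

context fractal_curve_param
begin

text \<open>
  The value \<open>0\<close> at nonpositive levels makes this a Borel function on the whole line; \<open>T\<close> is
  unspecified at negative arguments.
\<close>

definition along_levels :: "(real ^ 'd \<Rightarrow> complex) \<Rightarrow> real \<Rightarrow> complex" where
  "along_levels k x = (if x > 0 then k (v (T x)) else 0)"

lemma complex_F_integral_eq_integral:
  assumes [measurable]: "along_levels k \<in> borel_measurable borel"
    and osl: "one_sided_limits (\<lambda>t. k (v t)) a b" and ab: "0 \<le> a" "ereal a < b"
  shows "complex_F_integrable v \<alpha> k a b \<longleftrightarrow> set_integrable lborel (level_range a b) (along_levels k)"
    and "complex_F_integrable v \<alpha> k a b \<Longrightarrow>
      complex_F_integral v \<alpha> k a b = (LINT x:level_range a b|lborel. along_levels k x)"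
proof -
  let ?E = "level_range a b"
  have E_pos: "x > 0" if "x \<in> ?E" for x
    using that S_nonneg[OF ab(1)] by (simp add: level_range_def)
  have "indicator {0<..} x *\<^sub>R Re (k (v (T x))) = Re (along_levels k x)"
    "indicator {0<..} x *\<^sub>R Im (k (v (T x))) = Im (along_levels k x)" for x
    by (simp_all add: along_levels_def)
  then have meas: "level_measurable (\<lambda>t. Re (k (v t)))" "level_measurable (\<lambda>t. Im (k (v t)))"
    by (simp_all add: set_borel_measurable_def)
  have osl_Re: "one_sided_limits (\<lambda>t. Re (k (v t))) a b" and osl_Im: "one_sided_limits (\<lambda>t. Im (k (v t))) a b"
    using one_sided_limits_compose[OF osl continuous_on_Re[OF continuous_on_id]]
      one_sided_limits_compose[OF osl continuous_on_Im[OF continuous_on_id]] by simp_all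
  have cong: "set_integrable lborel ?E (\<lambda>x. Re (k (v (T x)))) \<longleftrightarrow> set_integrable lborel ?E (\<lambda>x. Re (along_levels k x))"
    "set_integrable lborel ?E (\<lambda>x. Im (k (v (T x)))) \<longleftrightarrow> set_integrable lborel ?E (\<lambda>x. Im (along_levels k x))"
    by (intro set_integrable_cong; simp add: E_pos along_levels_def)+
  have cong': "(LINT x:?E|lborel. Re (k (v (T x)))) = (LINT x:?E|lborel. Re (along_levels k x))"
    "(LINT x:?E|lborel. Im (k (v (T x)))) = (LINT x:?E|lborel. Im (along_levels k x))"
    using E_pos level_range_sets[OF ab] by (auto intro!: set_lebesgue_integral_cong simp: along_levels_def)
  have Re_Im: "set_integrable lborel ?E (along_levels k) \<longleftrightarrow>
      set_integrable lborel ?E (\<lambda>x. Re (along_levels k x)) \<and> set_integrable lborel ?E (\<lambda>x. Im (along_levels k x))"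
  proof
    assume "set_integrable lborel ?E (\<lambda>x. Re (along_levels k x)) \<and> set_integrable lborel ?E (\<lambda>x. Im (along_levels k x))"
    then have "integrable lborel (\<lambda>x. of_real (indicator ?E x *\<^sub>R Re (along_levels k x)) +
        \<i> * complex_of_real (indicator ?E x *\<^sub>R Im (along_levels k x)))"
      unfolding set_integrable_def
      by (intro Bochner_Integration.integrable_add integrable_mult_right integrable_of_real) auto
    moreover have "(\<lambda>x. of_real (indicator ?E x *\<^sub>R Re (along_levels k x)) +
        \<i> * complex_of_real (indicator ?E x *\<^sub>R Im (along_levels k x))) = (\<lambda>x. indicator ?E x *\<^sub>R along_levels k x)"
      by (rule ext) (simp add: complex_eq_iff)
    ultimately show "set_integrable lborel ?E (along_levels k)"
      by (simp add: set_integrable_def)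
  next
    assume "set_integrable lborel ?E (along_levels k)"
    then have int: "integrable lborel (\<lambda>x. indicator ?E x *\<^sub>R along_levels k x)"
      by (simp add: set_integrable_def)
    show "set_integrable lborel ?E (\<lambda>x. Re (along_levels k x)) \<and> set_integrable lborel ?E (\<lambda>x. Im (along_levels k x))"
      using integrable_Re[OF int] integrable_Im[OF int] by (simp add: set_integrable_def)
  qed
  show *: "complex_F_integrable v \<alpha> k a b \<longleftrightarrow> set_integrable lborel ?E (along_levels k)"
    unfolding complex_F_integrable_def F_integral_eq_integral(1)[OF meas(1) osl_Re ab]
      F_integral_eq_integral(1)[OF meas(2) osl_Im ab] cong Re_Im ..
  assume int: "complex_F_integrable v \<alpha> k a b"
  then have "integrable lborel (\<lambda>x. indicator ?E x *\<^sub>R along_levels k x)"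
    using * by (simp add: set_integrable_def)
  then have "(LINT x:?E|lborel. Re (along_levels k x)) = Re (LINT x:?E|lborel. along_levels k x)"
    "(LINT x:?E|lborel. Im (along_levels k x)) = Im (LINT x:?E|lborel. along_levels k x)"
    unfolding set_lebesgue_integral_def by (simp_all flip: integral_Re integral_Im)
  then show "complex_F_integral v \<alpha> k a b = (LINT x:?E|lborel. along_levels k x)"
    using int F_integral_eq_integral(2)[OF meas(1) osl_Re ab] F_integral_eq_integral(2)[OF meas(2) osl_Im ab]
    by (simp add: complex_F_integral_def complex_F_integrable_def cong' complex_eq_iff)
qed

lemma riemann_liouville_along_levels:
  assumes f: "\<And>a b. 0 < a \<Longrightarrow> a < b \<Longrightarrow> piecewise_continuous_section v f a b"
    and x: "x > 0" and rl: "RL_defined v \<alpha> \<beta> f (v (T x))"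
  shows "set_integrable lborel {0<..<x} (\<lambda>t. along_levels f t * of_real ((x - t) powr (\<beta> - 1)))"
    and "along_levels (RL_integral v \<alpha> \<beta> f) x =
      (LINT t:{0<..<x}|lborel. along_levels f t * of_real ((x - t) powr (\<beta> - 1))) / of_real (Gamma \<beta>)"
proof -
  let ?k = "RL_integrand v \<alpha> \<beta> f (v (T x))"
  have T: "T x > 0"
    using less_T_iff[of x 0] x S_0 by simp
  have k: "?k (v t) = f (v t) * (1 / of_real ((x - S t) powr (1 - \<beta>)))" if "t \<ge> 0" for t
    using that T x by (simp add: RL_integrand_def curve_J_v S_T)
  have [measurable]: "along_levels f \<in> borel_measurable borel"
    using piecewise_continuous_levels(2)[OF f] by (simp add: along_levels_def[abs_def])
  have k_levels: "along_levels ?k = (\<lambda>t. along_levels f t * (1 / of_real ((x - t) powr (1 - \<beta>))))"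
    by (auto simp: along_levels_def k S_T T_nonneg)
  then have meas: "along_levels ?k \<in> borel_measurable borel"
    by simp
  have "isCont (\<lambda>t. 1 / complex_of_real ((x - S t) powr (1 - \<beta>))) t" if "0 < t" "t < T x" for t
  proof -
    have "x - S t > 0"
      using less_T_iff[of x t] that x by simp
    then show ?thesis
      using isCont_S[OF that(1)] by (intro continuous_intros) auto
  qed
  then have "one_sided_limits (\<lambda>t. f (v t) * (1 / of_real ((x - S t) powr (1 - \<beta>)))) 0 (ereal (T x))"
    by (intro one_sided_limits_mult one_sided_limits_isCont
        one_sided_limits_subset[OF piecewise_continuous_levels(1)[OF f]]) auto
  then have osl: "one_sided_limits (\<lambda>t. ?k (v t)) 0 (ereal (T x))"
    by (subst one_sided_limits_cong[OF k]) auto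
  have E: "level_range 0 (ereal (T x)) = {0<..<x}"
    using T x by (simp add: level_range_ereal S_0 S_T)
  have k_eq: "along_levels ?k t = along_levels f t * of_real ((x - t) powr (\<beta> - 1))" if "t \<in> {0<..<x}" for t
    using that powr_minus[of "x - t" "1 - \<beta>"] by (simp add: k_levels divide_inverse)
  have int: "complex_F_integrable v \<alpha> ?k 0 (ereal (T x))"
    using rl T by (simp add: RL_defined_def curve_param_v)
  have "set_integrable lborel {0<..<x} (along_levels ?k)"
    using complex_F_integral_eq_integral(1)[OF meas osl] int T E by simp
  then show "set_integrable lborel {0<..<x} (\<lambda>t. along_levels f t * of_real ((x - t) powr (\<beta> - 1)))"
    by (rule set_integrable_cong[THEN iffD1, rotated -1]) (auto simp: k_eq)
  have "complex_F_integral v \<alpha> ?k 0 (ereal (T x)) = (LINT t:{0<..<x}|lborel. along_levels ?k t)"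
    using complex_F_integral_eq_integral(2)[OF meas osl _ _ int] T E by simp
  also have "\<dots> = (LINT t:{0<..<x}|lborel. along_levels f t * of_real ((x - t) powr (\<beta> - 1)))"
    using k_eq by (intro set_lebesgue_integral_cong) auto
  finally show "along_levels (RL_integral v \<alpha> \<beta> f) x =
      (LINT t:{0<..<x}|lborel. along_levels f t * of_real ((x - t) powr (\<beta> - 1))) / of_real (Gamma \<beta>)"
    using x T by (simp add: along_levels_def RL_integral_def curve_param_v)
qed

text \<open>
  The strip in the existence condition gives absolute convergence: \<open>x\<^bsup>Re s-1\<^esup>\<close> is at most
  \<open>x\<^bsup>l1-1\<^esup>\<close> for \<open>x < 1\<close> and at most \<open>x\<^bsup>l2-1\<^esup>\<close> for \<open>x > 1\<close>.
\<close>

lemma mellin_along_levels: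
  assumes k: "mellin_exists v \<alpha> k s"
  shows "set_integrable lborel {0<..} (\<lambda>x. along_levels k x * of_real x powr (s - 1))"
    and "mellin v \<alpha> k s = (LINT x:{0<..}|lborel. along_levels k x * of_real x powr (s - 1))"
proof -
  let ?H = "\<lambda>x. along_levels k x * of_real x powr (s - 1)"
  have pw: "\<And>a b. 0 < a \<Longrightarrow> a < b \<Longrightarrow> piecewise_continuous_section v k a b"
    using k by (simp add: mellin_exists_def)
  obtain l1 l2 where l: "l1 < Re s" "Re s < l2"
    and int1: "F_integrable v \<alpha> (\<lambda>\<theta>. norm (k \<theta>) * curve_J v \<alpha> \<theta> powr (l1 - 1)) 0 (ereal (T 1))"
    and int2: "F_integrable v \<alpha> (\<lambda>\<theta>. norm (k \<theta>) * curve_J v \<alpha> \<theta> powr (l2 - 1)) (T 1) \<infinity>"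
    using k unfolding mellin_exists_def by blast
  have [measurable]: "along_levels k \<in> borel_measurable borel"
    using piecewise_continuous_levels(2)[OF pw] by (simp add: along_levels_def[abs_def])
  have osl: "one_sided_limits (\<lambda>t. k (v t)) 0 \<infinity>"
    by (rule piecewise_continuous_levels(1)[OF pw])
  have T1: "T 1 > 0"
    using less_T_iff[of 1 0] S_0 by simp
  have S_pos: "S t > 0" if "t > 0" for t
    using S_less_iff[of 0 t] S_0 that by simp
  have J: "curve_J v \<alpha> (v t) = S t" if "0 < t" for t
    using that by (simp add: curve_J_v)
  have modulus: "set_integrable lborel (level_range a b) (\<lambda>x. norm (along_levels k x) * x powr (l - 1))"
    if int: "F_integrable v \<alpha> (\<lambda>\<theta>. norm (k \<theta>) * curve_J v \<alpha> \<theta> powr (l - 1)) a b"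
      and ab: "0 \<le> a" "ereal a < b" for a b l
  proof -
    let ?h = "\<lambda>\<theta>. norm (k \<theta>) * curve_J v \<alpha> \<theta> powr (l - 1)"
    have eq: "?h (v (T x)) = norm (along_levels k x) * x powr (l - 1)" if "x > 0" for x
      using that by (simp add: along_levels_def curve_J_v T_nonneg S_T)
    have lm: "level_measurable (\<lambda>t. ?h (v t))"
    proof -
      have "(\<lambda>x. indicator {0<..} x *\<^sub>R ?h (v (T x))) =
          (\<lambda>x. indicator {0<..} x *\<^sub>R (norm (along_levels k x) * x powr (l - 1)))"
        using eq by (auto split: split_indicator)
      then show ?thesis
        unfolding set_borel_measurable_def by simp
    qed
    have osl_h: "one_sided_limits (\<lambda>t. ?h (v t)) a b"
    proof -
      have "isCont (\<lambda>t. S t powr (l - 1)) t" if "0 < t" for t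
        using isCont_S[OF that] S_pos[OF that] by (intro continuous_intros) auto
      then have "one_sided_limits (\<lambda>t. norm (k (v t)) * S t powr (l - 1)) 0 \<infinity>"
        by (intro one_sided_limits_mult one_sided_limits_compose[OF osl continuous_on_norm_id])
          (rule one_sided_limits_isCont)
      then have "one_sided_limits (\<lambda>t. ?h (v t)) 0 \<infinity>"
        by (subst one_sided_limits_cong[where w = "\<lambda>t. norm (k (v t)) * S t powr (l - 1)"]) (auto simp: J)
      then show ?thesis
        by (rule one_sided_limits_subset) (use ab in auto)
    qed
    have "set_integrable lborel (level_range a b) (\<lambda>x. ?h (v (T x)))"
      using F_integral_eq_integral(1)[where h = ?h, OF lm osl_h ab] int by simp
    moreover have "x > 0" if "x \<in> level_range a b" for x
      using that S_nonneg[OF ab(1)] by (simp add: level_range_def)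
    ultimately show ?thesis
      by (intro set_integrable_cong[THEN iffD1, OF refl refl eq]) auto
  qed
  have ereal_T1: "ereal 0 < ereal (T 1)" "ereal (T 1) < \<infinity>"
    using T1 by auto
  have "set_integrable lborel {0<..<1} ?H"
  proof (rule set_integrable_bound)
    show "set_integrable lborel {0<..<1} (\<lambda>x. norm (along_levels k x) * x powr (l1 - 1))"
      using modulus[OF int1 _ ereal_T1(1)] T1 by (simp add: level_range_ereal S_0 S_T)
    show "AE x in lborel. x \<in> {0<..<1} \<longrightarrow> norm (?H x) \<le> norm (norm (along_levels k x) * x powr (l1 - 1))"
      using l(1) by (auto simp: norm_mult norm_powr_real_powr intro!: mult_left_mono powr_mono')
  qed (simp add: set_borel_measurable_def)
  moreover have "set_integrable lborel {1<..} ?H"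
  proof (rule set_integrable_bound)
    show "set_integrable lborel {1<..} (\<lambda>x. norm (along_levels k x) * x powr (l2 - 1))"
      using modulus[OF int2 _ ereal_T1(2)] T1 by (simp add: level_range_infinity S_T)
    show "AE x in lborel. x \<in> {1<..} \<longrightarrow> norm (?H x) \<le> norm (norm (along_levels k x) * x powr (l2 - 1))"
      using l(2) by (auto simp: norm_mult norm_powr_real_powr intro!: mult_left_mono powr_mono)
  qed (simp add: set_borel_measurable_def)
  ultimately have "set_integrable lborel ({0<..<1} \<union> {1<..}) ?H"
    by (rule set_integrable_Un) auto
  then show int: "set_integrable lborel {0<..} ?H"
    by (subst set_integrable_discrete_difference[where X = "{1}" and B = "{0<..<1} \<union> {1<..}"]) auto
  let ?k = "\<lambda>\<theta>. k \<theta> * complex_of_real (curve_J v \<alpha> \<theta>) powr (s - 1)"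
  have k_levels: "along_levels ?k = (\<lambda>x. along_levels k x * of_real x powr (s - 1))"
    by (auto simp: along_levels_def curve_J_v T_nonneg S_T)
  then have meas: "along_levels ?k \<in> borel_measurable borel"
    by simp
  have "isCont (\<lambda>t. complex_of_real (S t) powr (s - 1)) t" if "0 < t" for t
    using isCont_S[OF that] S_pos[OF that] by (intro continuous_intros) auto
  then have "one_sided_limits (\<lambda>t. k (v t) * of_real (S t) powr (s - 1)) 0 \<infinity>"
    by (intro one_sided_limits_mult osl) (rule one_sided_limits_isCont)
  then have osl_k: "one_sided_limits (\<lambda>t. ?k (v t)) 0 \<infinity>"
    by (subst one_sided_limits_cong[where w = "\<lambda>t. k (v t) * of_real (S t) powr (s - 1)"]) (auto simp: J)
  have E: "level_range 0 \<infinity> = {0<..}"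
    by (simp add: level_range_infinity S_0)
  show "mellin v \<alpha> k s = (LINT x:{0<..}|lborel. ?H x)"
    using complex_F_integral_eq_integral[OF meas osl_k] int unfolding E k_levels
    by (simp add: mellin_def)
qed

end

text \<open>
  On \<open>(0,1)\<close> the factor \<open>(2 - t)\<^bsup>\<beta>-1\<^esup>\<close> stays away from \<open>0\<close>. So existence of the fractional integral at
  the level \<open>2\<close> makes \<open>f\<close> itself integrable at \<open>0\<close>.
\<close>

lemma set_integrable_near_0_of_riemann_liouville:
  fixes f :: "real \<Rightarrow> complex"
  assumes [measurable]: "f \<in> borel_measurable borel"
    and int: "set_integrable lborel {0<..<2} (\<lambda>t. f t * of_real ((2 - t) powr (\<beta> - 1)))"
  shows "set_integrable lborel {0<..<1} f"
proof -
  define C where "C = max 1 (2 powr (1 - \<beta>))"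
  have C: "(2 - t) powr (1 - \<beta>) \<le> C" if "t \<in> {0<..<1}" for t :: real
  proof (cases "\<beta> \<le> 1")
    case True
    then have "(2 - t) powr (1 - \<beta>) \<le> 2 powr (1 - \<beta>)"
      using that by (intro powr_mono2) auto
    then show ?thesis
      by (simp add: C_def)
  next
    case False
    then have "(2 - t) powr (1 - \<beta>) \<le> 1 powr (1 - \<beta>)"
      using that by (intro powr_mono2') auto
    then show ?thesis
      by (simp add: C_def)
  qed
  show ?thesis
  proof (rule set_integrable_bound)
    show "set_integrable lborel {0<..<1} (\<lambda>t. of_real C * (f t * of_real ((2 - t) powr (\<beta> - 1))))"
      by (intro set_integrable_mult_right set_integrable_subset[OF int]) auto
    show "AE t in lborel. t \<in> {0<..<1} \<longrightarrow> norm (f t) \<le> norm (of_real C * (f t * of_real ((2 - t) powr (\<beta> - 1))))"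
    proof (intro AE_I2 impI)
      fix t :: real assume t: "t \<in> {0<..<1}"
      have "(2 - t) powr (1 - \<beta>) * (2 - t) powr (\<beta> - 1) = 1"
        using t by (simp flip: powr_add)
      then have "norm (f t) = norm (f t) * ((2 - t) powr (1 - \<beta>) * (2 - t) powr (\<beta> - 1))"
        by simp
      also have "\<dots> \<le> norm (f t) * (C * (2 - t) powr (\<beta> - 1))"
        using C[OF t] by (intro mult_left_mono mult_right_mono) auto
      finally show "norm (f t) \<le> norm (of_real C * (f t * of_real ((2 - t) powr (\<beta> - 1))))"
        unfolding norm_mult norm_of_real by (simp add: C_def mult_ac)
    qed
  qed (simp add: set_borel_measurable_def)
qed

theorem theorem3:
  fixes F :: "(real ^ 'd) set" and v :: "real \<Rightarrow> real ^ 'd" and \<alpha> \<beta> :: real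
    and f :: "real ^ 'd \<Rightarrow> complex" and s :: complex
  assumes "fractal_curve F v \<alpha>"
    and "\<beta> > 0"
    and "\<And>\<theta>. \<theta> \<in> F \<Longrightarrow> RL_defined v \<alpha> \<beta> f \<theta>"
    and "mellin_exists v \<alpha> (RL_integral v \<alpha> \<beta> f) s"
    and "mellin_exists v \<alpha> f (s + complex_of_real \<beta>)"
    and "1 - s - complex_of_real \<beta> \<notin> \<int>\<^sub>\<le>\<^sub>0"
    and "1 - s \<notin> \<int>\<^sub>\<le>\<^sub>0"
  shows "mellin v \<alpha> (RL_integral v \<alpha> \<beta> f) s =
    Gamma (1 - s - complex_of_real \<beta>) / Gamma (1 - s) * mellin v \<alpha> f (s + complex_of_real \<beta>)"
proof -
  interpret fractal_curve_param F v \<alpha>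
    by unfold_locales (rule assms(1))
  let ?g = "RL_integral v \<alpha> \<beta> f"
  have pw: "\<And>a b. 0 < a \<Longrightarrow> a < b \<Longrightarrow> piecewise_continuous_section v f a b"
    "\<And>a b. 0 < a \<Longrightarrow> a < b \<Longrightarrow> piecewise_continuous_section v ?g a b"
    using assms(4,5) by (auto simp: mellin_exists_def)
  have meas [measurable]: "along_levels f \<in> borel_measurable borel" "along_levels ?g \<in> borel_measurable borel"
    using pw[THEN piecewise_continuous_levels(2)] by (simp_all add: along_levels_def[abs_def])
  have RL: "RL_defined v \<alpha> \<beta> f (v (T x))" if "x > 0" for x
    using assms(3) v_bij T_nonneg[of x] that by (auto simp: bij_betw_def)
  have "set_integrable lborel {0<..<2} (\<lambda>t. along_levels f t * of_real ((2 - t) powr (\<beta> - 1)))"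
    using riemann_liouville_along_levels(1)[OF pw(1) _ RL, of 2] by simp
  then have near_0: "set_integrable lborel {0<..<1} (along_levels f)"
    by (rule set_integrable_near_0_of_riemann_liouville[OF meas(1)])
  show ?thesis
    unfolding mellin_along_levels(2)[OF assms(4)] mellin_along_levels(2)[OF assms(5)]
  proof (rule mellin_riemann_liouville[OF meas assms(2) zero_less_one near_0])
    show "along_levels ?g x =
        (LINT t:{0<..<x}|lborel. along_levels f t * of_real ((x - t) powr (\<beta> - 1))) / of_real (Gamma \<beta>)"
      if "x > 0" for x
      using riemann_liouville_along_levels(2)[OF pw(1) that RL[OF that]] .
  qed (use mellin_along_levels(1)[OF assms(4)] mellin_along_levels(1)[OF assms(5)] assms(6,7) in auto)
qed

end
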